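(* Let $A\in L(X)$ be a bounded complex-linear operator, let $\mathcal E$ be an Archimedian generating set for the $\mathbb R$-cone $K_{\mathbb R}\subset X_{\mathbb R}$ and $\mathcal M$ a weak-$*$ generating set for the dual cone $K'_{\mathbb R}$. Let $\mathcal T(A)\subset M_2(\mathbb C)$ be the collection of all matrices $$\begin{pmatrix}\langle m_1,Ae_1\rangle & \langle m_2,Ae_1\rangle\\ \langle m_1,Ae_2\rangle & \langle m_2,Ae_2\rangle\end{pmatrix},\qquad e_1,e_2\in\mathcal E,\ m_1,m_2\in\mathcal M .$$ Assume that $K_{\mathbb R}$ is of $\kappa$-bounded sectional aperture (for some $\kappa>0$) and is reproducing. If $\mathcal T(A)\subset\Gamma_+(\theta)$ for some $\theta\in[0,1)$, then $A$ has a spectral gap for which $\eta_{\rm sp}(A)\le\eta_1(\theta)<1$. More precisely, there are elements $h\in K_{\mathbb C}$, $\nu\in K'_{\mathbb C}$ and constants $\lambda\in\mathbb C\setminus\{0\}$, $C<+\infty$ so that for all $n\ge1$ and $x\in X$: $$\|\lambda^{-n}A^nx-h\,\langle\nu,x\rangle\|\le C\,(\eta_1(\theta))^{n-1}\,\|x\|.$$ Moreover, for every $x\in K_{\mathbb C}^*$ we have $\langle\nu,x\rangle\ne0$.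
   Context: $X_{\mathbb R}$ is a real Banach space, $X_{\mathbb R}\neq\{0\}$, and $X=X_{\mathbb R}\oplus iX_{\mathbb R}$ is a complexification of it (a complex Banach space containing $X_{\mathbb R}$ as a closed real subspace with the restricted norm). $X'_{\mathbb R}$, $X'$ are the topological duals, $\langle\cdot,\cdot\rangle$ the canonical (bilinear) dualities, and real functionals are extended complex-linearly to $X$. An $\mathbb R$-cone $K_{\mathbb R}$ in $X_{\mathbb R}$ is a closed subset with $K_{\mathbb R}+K_{\mathbb R}=K_{\mathbb R}$, $\mathbb R_+K_{\mathbb R}=K_{\mathbb R}$, $K_{\mathbb R}\cap -K_{\mathbb R}=\{0\}$. Its dual cone is $K'_{\mathbb R}=\{\ell\in X'_{\mathbb R}:\langle\ell,x\rangle\ge 0\ \forall x\in K_{\mathbb R}\}$. Its canonical complexification and the complexified dual cone are $$K_{\mathbb C}=\{x\in X:\operatorname{Re}\langle\ell_1,x\rangle\overline{\langle\ell_2,x\rangle}\ge 0\ \ \forall\ell_1,\ell_2\in K'_{\mathbb R}\},\qquad K'_{\mathbb C}=\{\mu\in X':\operatorname{Re}\langle\mu,x_1\rangle\overline{\langle\mu,x_2\rangle}\ge 0\ \ \forall x_1,x_2\in K_{\mathbb R}\}.$$ A superscript $*$ on a cone denotes removal of the zero vector. For a set $S$, $\mathbb R_+(S)$ is the set of finite sums $\sum t_ku_k$, $t_k\ge 0$, $u_k\in S$. A generating set $\mathcal E$ for $K_{\mathbb R}$ is a subset of $K_{\mathbb R}^*$ with $K_{\mathbb R}=\overline{\mathbb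 R_+(\mathcal E)}$; it is Archimedian if for every $x\in K_{\mathbb R}^*$ there are $e\in\mathcal E$ and $t>0$ with $x-te\in K_{\mathbb R}$. A weak-$*$ generating set $\mathcal M$ for $K'_{\mathbb R}$ is a subset of $K'_{\mathbb R}\setminus\{0\}$ such that for every $\mu\in K'_{\mathbb R}$, all $y_1,\dots,y_p\in X$ and $\epsilon>0$ there is $\ell\in\mathbb R_+(\mathcal M)$ with $|\langle\ell,y_k\rangle-\langle\mu,y_k\rangle|<\epsilon$, $k=1,\dots,p$. $K_{\mathbb R}$ is of $\kappa$-bounded sectional aperture if for every two-dimensional plane $V=\operatorname{Span}\{x,y\}\subset X_{\mathbb R}$ there is a real linear functional $m$ of norm one with $\|\xi\|\le\kappa\langle m,\xi\rangle$ for all $\xi\in K_{\mathbb R}\cap V$. $K_{\mathbb R}$ is reproducing if there is $g<+\infty$ such that every $x\in X_{\mathbb R}$ can be written $x=y_1-y_2$ with $y_1,y_2\in K_{\mathbb R}$, $\|y_1\|+\|y_2\|\le g\|x\|$. Spectral gap: $A\in L(X)$ has a spectral gap if it has a non-zero eigenvalue $\lambda$ and an associated one-dimensional projection $P$ with $AP=PA=\lambda P$ such that $A-\lambda P$ has spectral radius strictly smaller than $|\lambda|$; then $\eta_{\rm sp}(A)=r_{\rm sp}(A-\lambda P)/|\lambda|<1$, with $r_{\rm sp}$ the spectral radius. Matrices: $\overset{\circ}{\Gamma}_+$ is the set of $\begin{pmatrix}a&b\\c&d\end{pmatrix}\in M_2(\mathbb C)$ with $|ad-bc|<\operatorname{Re}(a\bar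 d+b\bar c)$ and $\operatorname{Re}a\bar b,\operatorname{Re}a\bar c,\operatorname{Re}b\bar d,\operatorname{Re}c\bar d>0$. For $0\le\theta<1$, $\Gamma_+(\theta)$ is the set of those matrices in $\overset{\circ}{\Gamma}_+$ with $\frac{|ad-bc|}{\operatorname{Re}(a\bar d+b\bar c)}\le\theta$. Further $\delta_1(\theta)=\log\frac{1+\theta}{1-\theta}$ and $$\eta_1(\theta)=\tanh\frac{9\,\delta_1(\theta)}{4}=\frac{(1+\theta)^{9/2}-(1-\theta)^{9/2}}{(1+\theta)^{9/2}+(1-\theta)^{9/2}}<1.$$ *)

theory Defs
  imports "HOL-Analysis.Analysis"
begin

section \<open>Complex Banach spaces and their bounded operators\<close>

class complex_banach = banach +
  fixes scaleC :: "complex \<Rightarrow> 'a \<Rightarrow> 'a"  (infixr \<open>*\<^sub>C\<close> 75)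
  assumes scaleC_add_right: "c *\<^sub>C (x + y) = c *\<^sub>C x + c *\<^sub>C y"
    and scaleC_add_left: "(c + d) *\<^sub>C x = c *\<^sub>C x + d *\<^sub>C x"
    and scaleC_scaleC: "c *\<^sub>C (d *\<^sub>C x) = (c * d) *\<^sub>C x"
    and scaleR_scaleC: "r *\<^sub>R x = complex_of_real r *\<^sub>C x"
    and norm_scaleC: "norm (c *\<^sub>C x) = cmod c * norm x"

instantiation complex :: complex_banach
begin

definition scaleC_complex :: "complex \<Rightarrow> complex \<Rightarrow> complex" where
  "scaleC_complex c x = c * x"

instance
  by standard (simp_all add: scaleC_complex_def algebra_simps norm_mult scaleR_conv_of_real)

end

definition bounded_clinear :: "('a::complex_banach \<Rightarrow> 'b::complex_banach) \<Rightarrow> bool" where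
  "bounded_clinear f \<longleftrightarrow> bounded_linear f \<and> (\<forall>c x. f (c *\<^sub>C x) = c *\<^sub>C f x)"

definition op_spectrum :: "('a::complex_banach \<Rightarrow> 'a) \<Rightarrow> complex set" where
  "op_spectrum A =
    {z. \<not> (\<exists>R. bounded_clinear R \<and>
            R \<circ> (\<lambda>x. A x - z *\<^sub>C x) = id \<and> (\<lambda>x. A x - z *\<^sub>C x) \<circ> R = id)}"

text \<open>
  On a nonzero space the spectrum of a bounded operator is nonempty and bounded, so the real
  supremum below is the genuine one.
\<close>

definition op_spectral_radius :: "('a::complex_banach \<Rightarrow> 'a) \<Rightarrow> real" where
  "op_spectral_radius A = (SUP z\<in>op_spectrum A. cmod z)"

definition one_dim_projection :: "('a::complex_banach \<Rightarrow> 'a) \<Rightarrow> bool" where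
  "one_dim_projection P \<longleftrightarrow>
    bounded_clinear P \<and> P \<circ> P = P \<and> (\<exists>h. h \<noteq> 0 \<and> range P = range (\<lambda>c. c *\<^sub>C h))"

definition spectral_gap ::
    "('a::complex_banach \<Rightarrow> 'a) \<Rightarrow> complex \<Rightarrow> ('a \<Rightarrow> 'a) \<Rightarrow> bool" where
  "spectral_gap A l P \<longleftrightarrow>
    l \<noteq> 0 \<and> (\<exists>v. v \<noteq> 0 \<and> A v = l *\<^sub>C v) \<and> one_dim_projection P \<and>
    (\<forall>x. A (P x) = l *\<^sub>C P x) \<and> (\<forall>x. P (A x) = l *\<^sub>C P x) \<and>
    op_spectral_radius (\<lambda>x. A x - l *\<^sub>C P x) < cmod l"

definition eta_sp :: "('a::complex_banach \<Rightarrow> 'a) \<Rightarrow> complex \<Rightarrow> ('a \<Rightarrow> 'a) \<Rightarrow> real" where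
  "eta_sp A l P = op_spectral_radius (\<lambda>x. A x - l *\<^sub>C P x) / cmod l"


section \<open>Complexification of a real Banach space\<close>

text \<open>
  The real space is a type of its own, included in the complex one by a linear isometry
  \<open>\<iota>\<close>. Its range is then automatically closed, the real space being complete.
\<close>

definition complexification :: "('r::banach \<Rightarrow> 'x::complex_banach) \<Rightarrow> bool" where
  "complexification \<iota> \<longleftrightarrow>
    linear \<iota> \<and> (\<forall>x. norm (\<iota> x) = norm x) \<and> bij (\<lambda>(x, y). \<iota> x + \<i> *\<^sub>C \<iota> y)"

definition parts :: "('r::banach \<Rightarrow> 'x::complex_banach) \<Rightarrow> 'x \<Rightarrow> 'r \<times> 'r" where
  "parts \<iota> = inv (\<lambda>(x, y). \<iota> x + \<i> *\<^sub>C \<iota> y)"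

text \<open>The complex-linear extension of a real functional.\<close>

definition cext :: "('r::banach \<Rightarrow> 'x::complex_banach) \<Rightarrow> ('r \<Rightarrow>\<^sub>L real) \<Rightarrow> 'x \<Rightarrow> complex" where
  "cext \<iota> l z = complex_of_real (l (fst (parts \<iota> z))) + \<i> * complex_of_real (l (snd (parts \<iota> z)))"

lemma cext_eq:
  assumes "complexification \<iota>"
  shows "cext \<iota> l (\<iota> x + \<i> *\<^sub>C \<iota> y) = complex_of_real (l x) + \<i> * complex_of_real (l y)"
proof -
  have "inj (\<lambda>(x, y). \<iota> x + \<i> *\<^sub>C \<iota> y)"
    using assms by (simp add: complexification_def bij_is_inj)
  from inv_f_f[OF this, of "(x, y)"] show ?thesis
    by (simp add: cext_def parts_def)
qed


section \<open>Real cones, dual cones and their complexifications\<close>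

definition real_cone :: "'r::banach set \<Rightarrow> bool" where
  "real_cone K \<longleftrightarrow>
    closed K \<and> {x + y |x y. x \<in> K \<and> y \<in> K} = K \<and> {t *\<^sub>R x |t x. t \<ge> 0 \<and> x \<in> K} = K \<and>
    K \<inter> uminus ` K = {0}"

definition dual_cone :: "'r::banach set \<Rightarrow> ('r \<Rightarrow>\<^sub>L real) set" where
  "dual_cone K = {l. \<forall>x\<in>K. blinfun_apply l x \<ge> 0}"

definition complexified_cone :: "('r::banach \<Rightarrow> 'x::complex_banach) \<Rightarrow> 'r set \<Rightarrow> 'x set" where
  "complexified_cone \<iota> K =
    {z. \<forall>l\<^sub>1\<in>dual_cone K. \<forall>l\<^sub>2\<in>dual_cone K. Re (cext \<iota> l\<^sub>1 z * cnj (cext \<iota> l\<^sub>2 z)) \<ge> 0}"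

definition complexified_dual_cone ::
    "('r::banach \<Rightarrow> 'x::complex_banach) \<Rightarrow> 'r set \<Rightarrow> ('x \<Rightarrow> complex) set" where
  "complexified_dual_cone \<iota> K =
    {\<mu>. bounded_clinear \<mu> \<and> (\<forall>x\<^sub>1\<in>K. \<forall>x\<^sub>2\<in>K. Re (\<mu> (\<iota> x\<^sub>1) * cnj (\<mu> (\<iota> x\<^sub>2))) \<ge> 0)}"

definition nonneg_span :: "'v::real_vector set \<Rightarrow> 'v set" where
  "nonneg_span S =
    {(\<Sum>k<n. t k *\<^sub>R u k) |(n::nat) (t::nat \<Rightarrow> real) u. \<forall>k<n. t k \<ge> 0 \<and> u k \<in> S}"

definition generating_set :: "'r::banach set \<Rightarrow> 'r set \<Rightarrow> bool" where
  "generating_set E K \<longleftrightarrow> E \<subseteq> K - {0} \<and> K = closure (nonneg_span E)"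

definition archimedian :: "'r::banach set \<Rightarrow> 'r set \<Rightarrow> bool" where
  "archimedian E K \<longleftrightarrow> (\<forall>x\<in>K - {0}. \<exists>e\<in>E. \<exists>t>0. x - t *\<^sub>R e \<in> K)"

definition weak_star_generating_set ::
    "('r::banach \<Rightarrow> 'x::complex_banach) \<Rightarrow> ('r \<Rightarrow>\<^sub>L real) set \<Rightarrow> 'r set \<Rightarrow> bool" where
  "weak_star_generating_set \<iota> M K \<longleftrightarrow>
    M \<subseteq> dual_cone K - {0} \<and>
    (\<forall>\<mu>\<in>dual_cone K. \<forall>Y. finite Y \<longrightarrow> (\<forall>\<epsilon>>0. \<exists>l\<in>nonneg_span M.
      \<forall>y\<in>Y. cmod (cext \<iota> l y - cext \<iota> \<mu> y) < \<epsilon>))"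

definition bounded_sectional_aperture :: "real \<Rightarrow> 'r::banach set \<Rightarrow> bool" where
  "bounded_sectional_aperture \<kappa> K \<longleftrightarrow>
    (\<forall>x y. dim (span {x, y}) = 2 \<longrightarrow>
      (\<exists>m :: 'r \<Rightarrow>\<^sub>L real. norm m = 1 \<and> (\<forall>\<xi>\<in>K \<inter> span {x, y}. norm \<xi> \<le> \<kappa> * blinfun_apply m \<xi>)))"

definition reproducing :: "'r::banach set \<Rightarrow> bool" where
  "reproducing K \<longleftrightarrow>
    (\<exists>g::real. \<forall>x. \<exists>y\<^sub>1\<in>K. \<exists>y\<^sub>2\<in>K. x = y\<^sub>1 - y\<^sub>2 \<and> norm y\<^sub>1 + norm y\<^sub>2 \<le> g * norm x)"


section \<open>Two-by-two complex matrices\<close>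

text \<open>\<open>mat2 a b c d\<close> has rows \<open>(a, b)\<close> and \<open>(c, d)\<close>.\<close>

definition mat2 :: "complex \<Rightarrow> complex \<Rightarrow> complex \<Rightarrow> complex \<Rightarrow> complex^2^2" where
  "mat2 a b c d = vector [vector [a, b], vector [c, d]]"

definition Gamma_int :: "(complex^2^2) set" where
  "Gamma_int = {mat2 a b c d |a b c d.
    cmod (a * d - b * c) < Re (a * cnj d + b * cnj c) \<and>
    Re (a * cnj b) > 0 \<and> Re (a * cnj c) > 0 \<and> Re (b * cnj d) > 0 \<and> Re (c * cnj d) > 0}"

definition Gamma_plus :: "real \<Rightarrow> (complex^2^2) set" where
  "Gamma_plus \<theta> = {mat2 a b c d |a b c d.
    mat2 a b c d \<in> Gamma_int \<and> cmod (a * d - b * c) / Re (a * cnj d + b * cnj c) \<le> \<theta>}"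

definition transfer_matrices ::
    "('r::banach \<Rightarrow> 'x::complex_banach) \<Rightarrow> 'r set \<Rightarrow> ('r \<Rightarrow>\<^sub>L real) set \<Rightarrow> ('x \<Rightarrow> 'x) \<Rightarrow> (complex^2^2) set"
  where
  "transfer_matrices \<iota> E M A =
    {mat2 (cext \<iota> m\<^sub>1 (A (\<iota> e\<^sub>1))) (cext \<iota> m\<^sub>2 (A (\<iota> e\<^sub>1)))
          (cext \<iota> m\<^sub>1 (A (\<iota> e\<^sub>2))) (cext \<iota> m\<^sub>2 (A (\<iota> e\<^sub>2)))
     |e\<^sub>1 e\<^sub>2 m\<^sub>1 m\<^sub>2. e\<^sub>1 \<in> E \<and> e\<^sub>2 \<in> E \<and> m\<^sub>1 \<in> M \<and> m\<^sub>2 \<in> M}"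

definition delta1 :: "real \<Rightarrow> real" where
  "delta1 \<theta> = ln ((1 + \<theta>) / (1 - \<theta>))"

definition eta1 :: "real \<Rightarrow> real" where
  "eta1 \<theta> = tanh (9 * delta1 \<theta> / 4)"

end

theory Submission
  imports Defs
begin

text \<open>
  A point of the complexified cone is a complex multiple of \<open>u + \<i>v\<close> with \<open>u, v\<close> in the real cone:
  the values of the positive functionals at it are pairwise at an angle of at most \<open>\<pi>/2\<close>, so a
  rotation brings all of them into one quadrant. The operator is therefore controlled by the
  numbers \<open>m (A e)\<close>, and the condition on a \<open>2\<times>2\<close> matrix \<open>a, b, c, d\<close> of such numbers has a
  geometric meaning: the Moebius map \<open>w \<mapsto> (a + w c) / (b + w d)\<close> sends the right half-plane into a
  disc of centre \<open>C\<close> and radius at most \<open>\<theta> Re C\<close>, whose hyperbolic diameter in the half-plane is at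
  most \<open>\<delta>\<^sub>1 = log ((1 + \<theta>) / (1 - \<theta>))\<close>. The inequality
  \<open>\<bar>a d - b c\<bar> \<le> \<theta> Re (a cnj d + b cnj c)\<close> is stable under nonnegative combinations of either
  vector, because the determinant and the real part are real-bilinear in the two vectors; so it
  spreads from the generating set to the whole real cone (\<open>closed_Gamma_K\<close>), while the
  functionals may stay in the weak-star generating set, which already determines both cones
  (\<open>K_iff\<close>, \<open>KC_iff\<close>; this is where the Hahn-Banach theorem enters).

  For vectors and functionals taken from one \<open>2\<times>2\<close> block, complex combinations included, the
  modulus of the cross-ratio is at most \<open>exp \<delta>\<^sub>1\<close> (\<open>cross_ratio_2x2\<close>, whose core is Ptolemy's
  inequality). Two points of the complexified cone involve four real vectors and are joined by
  three such steps, and likewise two complex functionals; hence the cross-ratio of arbitrary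
  pairs is at most \<open>exp (9 \<delta>\<^sub>1)\<close> (\<open>pencils_cross_ratio\<close>), which explains the 9 in \<open>eta1\<close>.

  From here on the argument is the one of Birkhoff and Hopf. The ratios \<open>f x / f y\<close>, with \<open>f\<close>
  ranging over the complex functionals, form a bounded plane set; applying \<open>A\<close> to \<open>x\<close> and \<open>y\<close>
  shrinks its diameter by the factor \<open>tanh (9 \<delta>\<^sub>1 / 4)\<close>, as one sees on the line through two of its
  points (\<open>oscillation_shrinks\<close>, \<open>ratios_contraction\<close>). So the ratios of \<open>A\<^sup>n x\<close> and \<open>A\<^sup>n y\<close> converge
  geometrically to a number \<open>\<nu> x\<close>, a bounded functional with \<open>\<nu> \<circ> A = \<lambda> \<nu>\<close> (\<open>leading_functional\<close>).
  Bounded sectional aperture turns closeness of all ratios into closeness in norm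
  (\<open>ex_norm_bound_of_dominated\<close>), so \<open>\<lambda>\<^sup>-\<^sup>n A\<^sup>n y\<close> converges to an eigenvector \<open>h\<close>, and the Neumann
  series of \<open>A - \<lambda> P\<close> with \<open>P x = \<nu> x h\<close> bounds the rest of the spectrum
  (\<open>spectral_gap_exists\<close>).
\<close>

section \<open>Bounded preimages under surjective operators\<close>

text \<open>
  Baire's theorem: the closed sets \<open>S n\<close> cover the complete target space, so one of them contains a
  ball. Differences of points of that ball and scaling give every \<open>y\<close>, approximately, with a
  preimage of comparable norm.
\<close>

lemma surjective_image_ball_dense:
  fixes f :: "'a::real_normed_vector \<Rightarrow> 'b::banach"
  assumes f: "linear f" and surj: "surj f"
  obtains c where "\<And>y e. e > 0 \<Longrightarrow> \<exists>x. norm x \<le> c * norm y \<and> norm (y - f x) < e"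
proof -
  interpret f: linear f by fact
  define S where "S n = closure (f ` cball 0 (real n))" for n :: nat
  have "\<exists>n. interior (S n) \<noteq> {}"
  proof (rule ccontr)
    assume "\<nexists>n. interior (S n) \<noteq> {}"
    then have empty: "interior (S n) = {}" for n by auto
    have "Met_TC.mtopology interior_of \<Union>(range S) = {}"
    proof (rule Met_TC.metric_Baire_category_alt)
      show "Met_TC.mcomplete TYPE('b)"
        by (simp add: complete_UNIV)
      show "closedin Met_TC.mtopology T \<and> Met_TC.mtopology interior_of T = {}"
        if "T \<in> range S" for T
        using that empty by (auto simp: S_def)
    qed simp
    moreover have "\<Union>(range S) = UNIV"
    proof (intro set_eqI iffI UNIV_I)
      fix y
      obtain x where x: "y = f x" using surj by (metis surj_def)
      obtain n where "norm x \<le> real n" using real_arch_simple by blast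
      then have "y \<in> S n" unfolding S_def x using closure_subset by fastforce
      then show "y \<in> \<Union>(range S)" by blast
    qed
    ultimately show False by simp
  qed
  then obtain n y0 where "y0 \<in> interior (S n)" by blast
  then obtain r where r: "r > 0" "ball y0 r \<subseteq> S n"
    by (meson mem_interior)
  have near: "\<exists>x. norm x \<le> real n \<and> norm (y - f x) < e" if "norm (y - y0) < r" "e > 0" for y e
  proof -
    have "y \<in> closure (f ` cball 0 (real n))"
      using that r by (auto simp: S_def dist_norm norm_minus_commute subset_eq)
    then obtain z where "z \<in> f ` cball 0 (real n)" "dist z y < e"
      using \<open>e > 0\<close> closure_approachable by blast
    then show ?thesis by (auto simp: dist_norm norm_minus_commute)
  qed
  show ?thesis
  proof (rule that[of "4 * real n / r"])
    fix y :: 'b and e :: real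
    assume "e > 0"
    show "\<exists>x. norm x \<le> 4 * real n / r * norm y \<and> norm (y - f x) < e"
    proof (cases "y = 0")
      case True
      then show ?thesis using \<open>e > 0\<close> by (intro exI[of _ 0]) (simp add: f.zero)
    next
      case False
      define t where "t = 2 * norm y / r"
      have t: "t > 0" using False r by (simp add: t_def)
      let ?y = "y /\<^sub>R t"
      have "norm ?y < r" using False r by (simp add: t_def divide_simps)
      then obtain x1 where x1: "norm x1 \<le> n" "norm (y0 + ?y - f x1) < e / (2 * t)"
        using near[of "y0 + ?y" "e / (2 * t)"] t \<open>e > 0\<close> by auto
      obtain x2 where x2: "norm x2 \<le> n" "norm (y0 - f x2) < e / (2 * t)"
        using near[of y0 "e / (2 * t)"] t \<open>e > 0\<close> r by auto
      let ?x = "t *\<^sub>R (x1 - x2)"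
      have "y - f ?x = t *\<^sub>R ((y0 + ?y - f x1) - (y0 - f x2))"
        using t by (simp add: f.scale f.diff algebra_simps)
      then have "norm (y - f ?x) = t * norm ((y0 + ?y - f x1) - (y0 - f x2))"
        using t by simp
      also have "\<dots> \<le> t * (norm (y0 + ?y - f x1) + norm (y0 - f x2))"
        using t by (intro mult_left_mono norm_triangle_ineq4) auto
      also have "\<dots> < t * (e / (2 * t) + e / (2 * t))"
        using x1 x2 t by (intro mult_strict_left_mono add_strict_mono)
      also have "\<dots> = e" using t by (simp add: field_simps)
      finally have "norm (y - f ?x) < e" .
      moreover have "norm ?x \<le> 4 * real n / r * norm y"
      proof -
        have "norm (x1 - x2) \<le> 2 * n"
          using x1 x2 norm_triangle_ineq4[of x1 x2] by linarith
        then have "t * norm (x1 - x2) \<le> t * (2 * n)"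
          using t by (intro mult_left_mono) auto
        moreover have "norm ?x = t * norm (x1 - x2)" using t by simp
        moreover have "t * (2 * n) = 4 * real n / r * norm y" by (simp add: t_def)
        ultimately show ?thesis by linarith
      qed
      ultimately show ?thesis by blast
    qed
  qed
qed

text \<open>
  The open mapping theorem in quantitative form. Correcting the error of an approximate preimage
  by an approximate preimage of the error halves it each time, and the corrections sum up.
  It is used for the continuity of the real and imaginary part in a complexification, where only
  the norm on the real part is prescribed.
\<close>

theorem bounded_linear_surj_bounded_preimage:
  fixes f :: "'a::banach \<Rightarrow> 'b::banach"
  assumes f: "bounded_linear f" and surj: "surj f"
  obtains c where "\<And>y. \<exists>x. f x = y \<and> norm x \<le> c * norm y"
proof -
  interpret f: bounded_linear f by fact
  obtain c where c: "\<And>y e. e > 0 \<Longrightarrow> \<exists>x. norm x \<le> c * norm y \<and> norm (y - f x) < e"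
    using surjective_image_ball_dense[OF f.linear_axioms surj] by blast
  have "\<exists>x. norm x \<le> c * norm y \<and> norm (y - f x) \<le> norm y / 2" for y
  proof (cases "y = 0")
    case True
    then show ?thesis by (intro exI[of _ 0]) (simp add: f.zero)
  next
    case False
    then show ?thesis using c[of "norm y / 2" y] by fastforce
  qed
  then obtain X where X: "\<And>y. norm (X y) \<le> c * norm y" "\<And>y. norm (y - f (X y)) \<le> norm y / 2"
    by metis
  have "\<exists>x. f x = y \<and> norm x \<le> 2 * c * norm y" for y
  proof -
    define r where "r n = ((\<lambda>z. z - f (X z)) ^^ n) y" for n
    have r_Suc: "r (Suc n) = r n - f (X (r n))" for n by (simp add: r_def)
    have r_norm: "norm (r n) \<le> (1/2) ^ n * norm y" for n
    proof (induction n)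
      case (Suc n)
      have "norm (r (Suc n)) \<le> norm (r n) / 2" unfolding r_Suc by (rule X)
      then show ?case using Suc by simp
    qed (simp add: r_def)
    have c0: "c \<ge> 0 \<or> y = 0"
      using X(1)[of y] norm_ge_zero[of "X y"]
      by (metis mult_neg_pos not_le order_trans zero_less_norm_iff)
    have X_norm: "norm (X (r n)) \<le> (1/2) ^ n * (c * norm y)" for n
    proof -
      have "norm (X (r n)) \<le> c * norm (r n)" by (rule X)
      also have "\<dots> \<le> c * ((1/2) ^ n * norm y)"
        using r_norm[of n] c0 by (auto intro: mult_left_mono)
      finally show ?thesis by (simp add: algebra_simps)
    qed
    have geo: "(\<lambda>n. (1/2::real) ^ n * (c * norm y)) sums (2 * (c * norm y))"
      using sums_mult2[OF geometric_sums[of "1/2::real"], of "c * norm y"] by simp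
    then have summ: "summable (\<lambda>n. norm (X (r n)))"
      by (intro summable_comparison_test'[OF sums_summable[OF geo], of 0]) (use X_norm in simp)
    define x where "x = (\<Sum>n. X (r n))"
    have "norm x \<le> (\<Sum>n. norm (X (r n)))" unfolding x_def by (rule summable_norm[OF summ])
    also have "\<dots> \<le> 2 * (c * norm y)"
      using suminf_le[OF X_norm summ sums_summable[OF geo]] sums_unique[OF geo] by simp
    finally have nx: "norm x \<le> 2 * c * norm y" by simp
    have "(\<lambda>n. f (X (r n))) sums f x"
      unfolding x_def by (rule f.sums[OF summable_sums[OF summable_norm_cancel[OF summ]]])
    then have "(\<lambda>n. r n - r (Suc n)) sums f x" by (simp add: r_Suc)
    moreover have "(\<lambda>n. (1/2::real) ^ n * norm y) \<longlonglongrightarrow> 0"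
      by (intro tendsto_mult_left_zero LIMSEQ_power_zero) auto
    then have "r \<longlonglongrightarrow> 0"
      by (rule Lim_null_comparison[OF always_eventually, rotated]) (use r_norm in auto)
    then have "(\<lambda>n. r n - r (Suc n)) sums (r 0 - 0)" by (rule telescope_sums')
    ultimately have "f x = y" using sums_unique2 by (fastforce simp: r_def)
    with nx show ?thesis by blast
  qed
  then show thesis using that by blast
qed

section \<open>Separating a point from a closed convex cone\<close>

definition sublinear :: "('a::real_vector \<Rightarrow> real) \<Rightarrow> bool" where
  "sublinear p \<longleftrightarrow>
    (\<forall>x y. p (x + y) \<le> p x + p y) \<and> (\<forall>t\<ge>0. \<forall>x. p (t *\<^sub>R x) \<le> t * p x)"

lemma sublinearD:
  assumes "sublinear p"
  shows "p (x + y) \<le> p x + p y" and "t \<ge> 0 \<Longrightarrow> p (t *\<^sub>R x) = t * p x" and "- p (- x) \<le> p x"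
proof -
  show add: "p (x + y) \<le> p x + p y" for x y using assms by (simp add: sublinear_def)
  have le: "p (t *\<^sub>R x) \<le> t * p x" if "t \<ge> 0" for t x using assms that by (simp add: sublinear_def)
  have p0: "p 0 = 0" using add[of 0 0] le[of 0 0] by simp
  show "- p (- x) \<le> p x" using add[of x "- x"] p0 by simp
  assume "t \<ge> 0"
  show "p (t *\<^sub>R x) = t * p x"
  proof (cases "t = 0")
    case False
    then have t: "t > 0" using \<open>t \<ge> 0\<close> by simp
    have "p x \<le> inverse t * p (t *\<^sub>R x)"
      using le[of "inverse t" "t *\<^sub>R x"] t by simp
    then have "t * p x \<le> p (t *\<^sub>R x)" using t by (simp add: field_simps)
    then show ?thesis using le[of t x] t by simp
  qed (simp add: p0)
qed

text \<open>
  The infimum of a family of sublinear functionals is sublinear as soon as the family is directed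
  downwards in the weak sense below. The hypotheses are phrased through single values so that the
  same lemma serves for chains, for \<open>tilt\<close> and for the distance to a cone.
\<close>

lemma sublinear_INF:
  fixes q :: "'i \<Rightarrow> 'a::real_vector \<Rightarrow> real"
  assumes ne: "I \<noteq> {}" and low: "\<And>i x. i \<in> I \<Longrightarrow> b x \<le> q i x"
    and add: "\<And>i j x y. i \<in> I \<Longrightarrow> j \<in> I \<Longrightarrow> \<exists>k\<in>I. q k (x + y) \<le> q i x + q j y"
    and scale: "\<And>i t x. i \<in> I \<Longrightarrow> t > 0 \<Longrightarrow> \<exists>k\<in>I. q k (t *\<^sub>R x) \<le> t * q i x"
    and zero: "\<exists>i\<in>I. q i 0 \<le> 0"
  shows "sublinear (\<lambda>x. INF i\<in>I. q i x)"
proof -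
  have bdd: "bdd_below ((\<lambda>i. q i x) ` I)" for x
    by (rule bdd_belowI2[of I "b x"]) (rule low)
  have up: "(INF i\<in>I. q i x) \<le> q k x" if "k \<in> I" for k x
    by (rule cINF_lower[OF bdd that])
  show ?thesis unfolding sublinear_def
  proof (intro conjI allI impI)
    fix x y
    have *: "(INF i\<in>I. q i (x + y)) - q i x \<le> (INF j\<in>I. q j y)" if i: "i \<in> I" for i
    proof (rule cINF_greatest[OF ne])
      fix j assume "j \<in> I"
      then obtain k where "k \<in> I" "q k (x + y) \<le> q i x + q j y" using add i by blast
      then show "(INF i\<in>I. q i (x + y)) - q i x \<le> q j y" using up[of k "x + y"] by linarith
    qed
    have "(INF i\<in>I. q i (x + y)) - (INF j\<in>I. q j y) \<le> (INF i\<in>I. q i x)"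
      by (rule cINF_greatest[OF ne]) (use * in \<open>simp add: algebra_simps\<close>)
    then show "(INF i\<in>I. q i (x + y)) \<le> (INF i\<in>I. q i x) + (INF i\<in>I. q i y)" by linarith
  next
    fix t :: real and x
    assume "t \<ge> 0"
    show "(INF i\<in>I. q i (t *\<^sub>R x)) \<le> t * (INF i\<in>I. q i x)"
    proof (cases "t = 0")
      case True
      then show ?thesis using zero up[of _ 0] by fastforce
    next
      case False
      then have t: "t > 0" using \<open>t \<ge> 0\<close> by simp
      have "(INF i\<in>I. q i (t *\<^sub>R x)) / t \<le> (INF i\<in>I. q i x)"
      proof (rule cINF_greatest[OF ne])
        fix i assume "i \<in> I"
        then obtain k where "k \<in> I" "q k (t *\<^sub>R x) \<le> t * q i x" using scale t by blast
        then have "(INF i\<in>I. q i (t *\<^sub>R x)) \<le> t * q i x" using up[of k "t *\<^sub>R x"] by linarith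
        then show "(INF i\<in>I. q i (t *\<^sub>R x)) / t \<le> q i x" using t by (simp add: field_simps)
      qed
      then show ?thesis using t by (simp add: field_simps)
    qed
  qed
qed

definition tilt :: "('a::real_vector \<Rightarrow> real) \<Rightarrow> 'a \<Rightarrow> 'a \<Rightarrow> real" where
  "tilt p v x = (INF t\<in>{0..}. p (x + t *\<^sub>R v) - t * p v)"

text \<open>
  Tilting preserves sublinearity, lies below \<open>p\<close> (take \<open>t = 0\<close>) and is at most \<open>- p v\<close> at \<open>- v\<close>
  (take \<open>t = 1\<close>): this forces additivity of a minimal sublinear functional, and pins down its
  value at a chosen point.
\<close>

lemma sublinear_tilt:
  assumes p: "sublinear p"
  shows "sublinear (tilt p v)" and "t \<ge> 0 \<Longrightarrow> tilt p v x \<le> p (x + t *\<^sub>R v) - t * p v"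
proof -
  note [simp] = sublinearD(2)[OF p]
  have low: "- p (- x) \<le> p (x + t *\<^sub>R v) - t * p v" if "t \<in> {0..}" for t x
    using sublinearD(1)[OF p, of "x + t *\<^sub>R v" "- x"] that by simp
  show "t \<ge> 0 \<Longrightarrow> tilt p v x \<le> p (x + t *\<^sub>R v) - t * p v"
    unfolding tilt_def by (rule cINF_lower[OF bdd_belowI2[OF low]]) auto
  show "sublinear (tilt p v)"
    unfolding tilt_def
  proof (rule sublinear_INF[OF _ low])
    fix s t x y assume st: "s \<in> {0::real..}" "t \<in> {0::real..}"
    have "p ((x + y) + (s + t) *\<^sub>R v) \<le> p (x + s *\<^sub>R v) + p (y + t *\<^sub>R v)"
      using sublinearD(1)[OF p, of "x + s *\<^sub>R v" "y + t *\<^sub>R v"] by (simp add: algebra_simps)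
    then show "\<exists>k\<in>{0..}. p (x + y + k *\<^sub>R v) - k * p v \<le> p (x + s *\<^sub>R v) - s * p v + (p (y + t *\<^sub>R v) - t * p v)"
      using st by (intro bexI[of _ "s + t"]) (auto simp: algebra_simps)
  next
    fix s t x assume st: "s \<in> {0::real..}" "t > (0::real)"
    have "p (t *\<^sub>R x + (t * s) *\<^sub>R v) = t * p (x + s *\<^sub>R v)"
      using sublinearD(2)[OF p, of t "x + s *\<^sub>R v"] st by (simp add: algebra_simps)
    then show "\<exists>k\<in>{0..}. p (t *\<^sub>R x + k *\<^sub>R v) - k * p v \<le> t * (p (x + s *\<^sub>R v) - s * p v)"
      using st by (intro bexI[of _ "t * s"]) (auto simp: algebra_simps)
  next
    show "\<exists>t\<in>{0..}. p (0 + t *\<^sub>R v) - t * p v \<le> 0"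
      by (intro bexI[of _ 0]) (use sublinearD(2)[OF p, of 0 v] in auto)
  qed auto
qed

text \<open>
  Zorn's lemma for the reversed pointwise order. A chain is bounded below pointwise because
  \<open>- p (- x) \<le> q x\<close> for every sublinear \<open>q \<le> p\<close>.
\<close>

lemma minimal_sublinear:
  assumes p: "sublinear p"
  obtains q where "sublinear q" "\<And>x. q x \<le> p x"
    "\<And>r. sublinear r \<Longrightarrow> (\<And>x. r x \<le> q x) \<Longrightarrow> r = q"
proof -
  define S where "S = {q. sublinear q \<and> (\<forall>x. q x \<le> p x)}"
  have "\<exists>q\<in>S. \<forall>r\<in>S. r \<le> q \<longrightarrow> r = q"
  proof (rule predicate_Zorn)
    show "partial_order_on S (relation_of (\<lambda>a b. b \<le> a) S)"
      by (rule partial_order_on_relation_ofI) auto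
  next
    fix C assume C: "C \<in> Chains (relation_of (\<lambda>a b. b \<le> a) S)"
    then have "C \<subseteq> S" by (auto simp: Chains_def relation_of_def)
    then have sub: "sublinear q" and le_p: "q x \<le> p x" if "q \<in> C" for q x
      using that by (auto simp: S_def)
    show "\<exists>u\<in>S. \<forall>a\<in>C. u \<le> a"
    proof (cases "C = {}")
      case True
      then show ?thesis using p by (auto simp: S_def)
    next
      case False
      have low: "- p (- x) \<le> q x" if "q \<in> C" for q x
        using sublinearD(3)[OF sub[OF that], of x] le_p[OF that, of "- x"] by linarith
      have up: "(INF q\<in>C. q x) \<le> q x" if "q \<in> C" for q x
        by (rule cINF_lower[OF bdd_belowI2[OF low] that])
      have "sublinear (\<lambda>x. INF q\<in>C. q x)"
      proof (rule sublinear_INF[OF False low])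
        fix q r x y assume qr: "q \<in> C" "r \<in> C"
        have *: "\<exists>k\<in>C. k \<le> q \<and> k \<le> r"
          using C qr by (auto simp: Chains_def relation_of_def)
        then obtain k where k: "k \<in> C" "k x \<le> q x" "k y \<le> r y" by (auto simp: le_fun_def)
        then show "\<exists>k\<in>C. k (x + y) \<le> q x + r y"
          using sublinearD(1)[OF sub, of k x y] by (intro bexI[of _ k]) auto
      next
        fix q and t :: real and x assume "q \<in> C" "t > 0"
        then show "\<exists>k\<in>C. k (t *\<^sub>R x) \<le> t * q x"
          using sublinearD(2)[OF sub, of q t x] by (intro bexI[of _ q]) auto
      next
        show "\<exists>q\<in>C. q 0 \<le> 0"
          using False sublinearD(2)[OF sub, of _ 0 0] by fastforce
      qed
      moreover have "(INF q\<in>C. q x) \<le> p x" for x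
        using False up[of _ x] le_p[of _ x] by (meson ex_in_conv order_trans)
      ultimately show ?thesis using up
        by (intro bexI[of _ "\<lambda>x. INF q\<in>C. q x"]) (auto simp: S_def le_fun_def)
    qed
  qed
  then obtain q where q: "q \<in> S" "\<And>r. r \<in> S \<Longrightarrow> r \<le> q \<Longrightarrow> r = q" by blast
  show ?thesis
  proof (rule that)
    show "sublinear q" "q x \<le> p x" for x using q by (auto simp: S_def)
    fix r assume "sublinear r" "\<And>x. r x \<le> q x"
    moreover from this q(1) have "r \<in> S" by (auto simp: S_def intro: order_trans)
    ultimately show "r = q" using q(2) by (simp add: le_fun_def)
  qed
qed

text \<open>
  A minimal sublinear functional equals each of its tilts, hence is additive, hence linear.
  Starting from \<open>tilt p v\<close> instead of \<open>p\<close> makes the value at \<open>v\<close> as large as possible.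
\<close>

theorem hahn_banach_sublinear:
  assumes p: "sublinear p"
  obtains l where "linear l" "\<And>x. l x \<le> p x" "l v = p v"
proof -
  obtain q where q: "sublinear q" "\<And>x. q x \<le> tilt p v x"
    and min: "\<And>r. sublinear r \<Longrightarrow> (\<And>x. r x \<le> q x) \<Longrightarrow> r = q"
    using minimal_sublinear[OF sublinear_tilt(1)[OF p]] by blast
  note scale = sublinearD(2)[OF q(1)]
  have add: "q (x + y) = q x + q y" for x y
  proof (rule antisym[OF sublinearD(1)[OF q(1)]])
    \<comment> \<open>Minimality gives \<open>q x \<le> q (x + y) - q y\<close>.\<close>
    have "tilt q y = q"
      using scale[of 0 0] sublinear_tilt(2)[OF q(1), of 0 y] by (intro min sublinear_tilt(1)[OF q(1)]) simp
    then show "q x + q y \<le> q (x + y)" using sublinear_tilt(2)[OF q(1), of 1 y x] by simp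
  qed
  have q0: "q 0 = 0" using add[of 0 0] by simp
  have neg: "q (- x) = - q x" for x using add[of x "- x"] q0 by simp
  have lin: "linear q"
  proof (rule linearI[OF add])
    fix t :: real and x
    show "q (t *\<^sub>R x) = t *\<^sub>R q x"
      using scale[of t x] scale[of "- t" x] neg[of "t *\<^sub>R x"] by (cases "t \<ge> 0") auto
  qed
  have le: "q x \<le> p x" for x
    using q(2)[of x] sublinear_tilt(2)[OF p, of 0 v x] by simp
  have "q (- v) \<le> - p v"
    using q(2)[of "- v"] sublinear_tilt(2)[OF p, of 1 v "- v"] sublinearD(2)[OF p, of 0 0] by simp
  then have "q v = p v" using neg[of v] le[of v] by simp
  with lin le show ?thesis using that by blast
qed

text \<open>
  The Hahn-Banach theorem is applied to the distance to \<open>- K\<close>, which is sublinear, vanishes on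
  \<open>- K\<close> and is positive at \<open>- x\<close>.
\<close>

theorem separating_functional_closed_cone:
  fixes K :: "'a::real_normed_vector set"
  assumes closed: "closed K" and zero: "0 \<in> K"
    and add: "\<And>x y. x \<in> K \<Longrightarrow> y \<in> K \<Longrightarrow> x + y \<in> K"
    and scale: "\<And>t x. t \<ge> 0 \<Longrightarrow> x \<in> K \<Longrightarrow> t *\<^sub>R x \<in> K"
    and x: "x \<notin> K"
  obtains l :: "'a \<Rightarrow>\<^sub>L real" where "\<And>k. k \<in> K \<Longrightarrow> blinfun_apply l k \<ge> 0" "blinfun_apply l x < 0"
proof -
  define p where "p y = (INF k\<in>K. norm (y + k))" for y
  have up: "p y \<le> norm (y + k)" if "k \<in> K" for y k
    unfolding p_def by (rule cINF_lower[OF _ that]) (auto intro: bdd_belowI2[of _ 0])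
  have p: "sublinear p"
    unfolding p_def
  proof (rule sublinear_INF[where b = "\<lambda>_. 0"])
    fix j k u v assume "j \<in> K" "k \<in> K"
    then show "\<exists>l\<in>K. norm (u + v + l) \<le> norm (u + j) + norm (v + k)"
      using norm_triangle_ineq[of "u + j" "v + k"]
      by (intro bexI[of _ "j + k"] add) (auto simp: algebra_simps)
  next
    fix k t u assume "k \<in> K" "t > (0::real)"
    then show "\<exists>l\<in>K. norm (t *\<^sub>R u + l) \<le> t * norm (u + k)"
      by (intro bexI[of _ "t *\<^sub>R k"] scale) (auto simp flip: scaleR_add_right)
  qed (use zero in auto)
  obtain l where l: "linear l" "\<And>y. l y \<le> p y" "l (- x) = p (- x)"
    using hahn_banach_sublinear[OF p] by blast
  interpret l: linear l by fact
  have "norm (l y) \<le> 1 * norm y" for y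
    using l(2)[of y] l(2)[of "- y"] up[OF zero, of y] up[OF zero, of "- y"] by (simp add: l.neg)
  then have bl: "bounded_linear l"
    by (intro bounded_linear_intro[of _ 1]) (auto simp: l.add l.scale mult.commute)
  show ?thesis
  proof (rule that[of "Blinfun l"])
    fix k assume "k \<in> K"
    then have "l (- k) \<le> 0" using l(2)[of "- k"] up[of k "- k"] by simp
    then show "blinfun_apply (Blinfun l) k \<ge> 0" by (simp add: bounded_linear_Blinfun_apply[OF bl] l.neg)
  next
    obtain e where e: "e > 0" "\<And>y. y \<in> K \<Longrightarrow> dist y x \<ge> e"
      using closed x closed_approachable by (metis not_le)
    have "p (- x) \<ge> e" unfolding p_def
      using e(2) zero by (intro cINF_greatest) (auto simp: dist_norm)
    then show "blinfun_apply (Blinfun l) x < 0"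
      using l(3) e(1) by (simp add: bounded_linear_Blinfun_apply[OF bl] l.neg)
  qed
qed

section \<open>Complex Banach spaces and resolvents\<close>

lemma scaleC_one [simp]: "1 *\<^sub>C x = (x :: 'a::complex_banach)"
  using scaleR_scaleC[of 1 x] by simp

lemma scaleC_zero_left [simp]: "0 *\<^sub>C x = (0 :: 'a::complex_banach)"
  using scaleR_scaleC[of 0 x] by simp

lemma scaleC_zero_right [simp]: "c *\<^sub>C (0 :: 'a::complex_banach) = 0"
  using scaleC_add_right[of c "0::'a" 0] by simp

lemma scaleC_minus_right: "c *\<^sub>C (- x) = - (c *\<^sub>C (x :: 'a::complex_banach))"
  using scaleC_add_right[of c x "- x"] by (simp add: eq_neg_iff_add_eq_0 add.commute)

lemma scaleC_diff_right: "c *\<^sub>C (x - y) = c *\<^sub>C x - c *\<^sub>C (y :: 'a::complex_banach)"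
  using scaleC_add_right[of c x "- y"] by (simp add: scaleC_minus_right)

lemma scaleC_minus_left: "(- c) *\<^sub>C x = - (c *\<^sub>C (x :: 'a::complex_banach))"
  using scaleC_add_left[of c "- c" x] by (simp add: eq_neg_iff_add_eq_0 add.commute)

lemma bounded_linear_scaleC_right: "bounded_linear (\<lambda>x::'a::complex_banach. c *\<^sub>C x)"
  by (rule bounded_linear_intro[of _ "cmod c"])
     (simp_all add: scaleC_add_right norm_scaleC scaleR_scaleC scaleC_scaleC mult.commute)

lemmas tendsto_scaleC_right = bounded_linear.tendsto[OF bounded_linear_scaleC_right]

lemma bounded_clinearD:
  assumes "bounded_clinear f"
  shows "bounded_linear f" "f (x + y) = f x + f y" "f (x - y) = f x - f y" "f 0 = 0"
    "f (c *\<^sub>C x) = c *\<^sub>C f x"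
  using assms linear_add[of f x y] linear_diff[of f x y] linear_0[of f]
  by (auto simp: bounded_clinear_def bounded_linear.linear)

lemma bounded_clinearI:
  assumes "\<And>x y. f (x + y) = f x + f y" "\<And>c x. f (c *\<^sub>C x) = c *\<^sub>C f x" "\<And>x. norm (f x) \<le> C * norm x"
  shows "bounded_clinear f"
  unfolding bounded_clinear_def
proof (intro conjI allI bounded_linear_intro[of f C])
  fix r x show "f (r *\<^sub>R x) = r *\<^sub>R f x" by (simp add: scaleR_scaleC assms)
qed (use assms in \<open>simp_all add: mult.commute\<close>)

lemma funpow_clinear:
  fixes A :: "'a::complex_banach \<Rightarrow> 'a"
  assumes "bounded_clinear A"
  shows "(A ^^ n) (u + v) = (A ^^ n) u + (A ^^ n) v" "(A ^^ n) (c *\<^sub>C u) = c *\<^sub>C (A ^^ n) u"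
  by (induction n) (simp_all add: bounded_clinearD[OF assms])

text \<open>
  The series \<open>S = \<Sum> z\<^sup>-\<^sup>n\<^sup>-\<^sup>1 B\<^sup>n\<close> converges absolutely, and \<open>B S = z S - 1 = S B\<close> by shifting the index.
  The bound on the powers starts at exponent 1, so that \<open>r = 0\<close> is allowed.
\<close>

lemma neumann_resolvent:
  fixes B :: "'a::complex_banach \<Rightarrow> 'a"
  assumes B: "bounded_clinear B" and r: "r \<ge> 0" and C: "C \<ge> 0"
    and bound: "\<And>n x. norm ((B ^^ Suc n) x) \<le> C * r ^ n * norm x" and z: "r < cmod z"
  shows "z \<notin> op_spectrum B"
proof -
  define a where "a n x = inverse (z ^ Suc n) *\<^sub>C (B ^^ n) x" for n x
  define S where "S x = (\<Sum>n. a n x)" for x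
  define t where "t = r / cmod z"
  define c where "c = C / (cmod z)\<^sup>2"
  have z0: "z \<noteq> 0" using r z by auto
  have t: "0 \<le> t" "t < 1" using r z z0 by (simp_all add: t_def)
  have c: "c \<ge> 0" using C by (simp add: c_def)
  have a_Suc: "norm (a (Suc n) x) \<le> c * norm x * t ^ n" for n x
  proof -
    have "norm (a (Suc n) x) = inverse (cmod z ^ Suc (Suc n)) * norm ((B ^^ Suc n) x)"
      by (simp only: a_def norm_scaleC norm_inverse norm_power)
    also have "\<dots> \<le> inverse (cmod z ^ Suc (Suc n)) * (C * r ^ n * norm x)"
      by (intro mult_left_mono bound) simp
    also have "\<dots> = c * norm x * t ^ n"
      using z0 by (simp add: c_def t_def power_divide field_simps power2_eq_square)
    finally show ?thesis .
  qed
  have geo: "(\<lambda>n. c * norm x * t ^ n) sums (c * norm x * (1 / (1 - t)))" for x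
    by (rule sums_mult[OF geometric_sums]) (use t in simp)
  have norm_sum: "summable (\<lambda>n. norm (a (Suc n) x))" for x
    by (rule summable_comparison_test'[OF sums_summable[OF geo[of x]], of 0]) (use a_Suc in simp)
  then have summ_Suc: "summable (\<lambda>n. a (Suc n) x)" for x by (rule summable_norm_cancel)
  then have summ: "summable (\<lambda>n. a n x)" for x by (subst summable_Suc_iff[symmetric])
  have a0: "a 0 x = inverse z *\<^sub>C x" for x by (simp add: a_def)
  have S_split: "S x = a 0 x + (\<Sum>n. a (Suc n) x)" for x
    using suminf_split_head[OF summ[of x]] by (simp add: S_def)
  have S_norm: "norm (S x) \<le> (inverse (cmod z) + c * (1 / (1 - t))) * norm x" for x
  proof -
    have "norm (\<Sum>n. a (Suc n) x) \<le> (\<Sum>n. norm (a (Suc n) x))" by (rule summable_norm[OF norm_sum])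
    also have "\<dots> \<le> (\<Sum>n. c * norm x * t ^ n)"
      by (rule suminf_le[OF a_Suc norm_sum sums_summable[OF geo]])
    also have "\<dots> = c * norm x * (1 / (1 - t))" by (rule sums_unique[OF geo, symmetric])
    finally have "norm (\<Sum>n. a (Suc n) x) \<le> c * norm x * (1 / (1 - t))" .
    moreover have "norm (a 0 x) = inverse (cmod z) * norm x" by (simp add: a0 norm_scaleC norm_inverse)
    ultimately show ?thesis unfolding S_split
      using norm_triangle_ineq[of "a 0 x" "\<Sum>n. a (Suc n) x"] by (simp add: algebra_simps)
  qed
  have S_add: "S (x + y) = S x + S y" for x y
    unfolding S_def by (subst suminf_add[OF summ summ]) (simp add: a_def funpow_clinear[OF B] scaleC_add_right)
  have S_scale: "S (d *\<^sub>C x) = d *\<^sub>C S x" for d x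
    unfolding S_def bounded_linear.suminf[OF bounded_linear_scaleC_right summ]
    by (simp add: a_def funpow_clinear[OF B] scaleC_scaleC mult.commute)
  have shift: "z *\<^sub>C a (Suc n) x = inverse (z ^ Suc n) *\<^sub>C (B ^^ Suc n) x" for n x
  proof -
    have "z * inverse (z ^ Suc (Suc n)) = inverse (z ^ Suc n)" using z0 by simp
    then show ?thesis by (simp only: a_def scaleC_scaleC)
  qed
  have S_tail: "(\<Sum>n. z *\<^sub>C a (Suc n) x) = z *\<^sub>C S x - x" for x
    unfolding bounded_linear.suminf[OF bounded_linear_scaleC_right summ_Suc, symmetric]
    using z0 by (simp add: S_split a0 scaleC_add_right scaleC_scaleC)
  have BS: "B (S x) = z *\<^sub>C S x - x" for x
    unfolding S_tail[symmetric] unfolding S_def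
    unfolding bounded_linear.suminf[OF bounded_clinearD(1)[OF B] summ]
    unfolding shift by (simp add: a_def bounded_clinearD[OF B])
  have SB: "S (B x) = z *\<^sub>C S x - x" for x
    unfolding S_tail[symmetric] unfolding shift
    unfolding S_def by (simp add: a_def funpow_swap1)
  define R where "R x = - S x" for x
  have "bounded_clinear R"
    by (rule bounded_clinearI[of _ "inverse (cmod z) + c * (1 / (1 - t))"])
      (use S_norm in \<open>simp_all add: R_def S_add S_scale scaleC_minus_right\<close>)
  moreover have "R \<circ> (\<lambda>x. B x - z *\<^sub>C x) = id"
  proof
    fix x
    have "S (B x - z *\<^sub>C x) + S (z *\<^sub>C x) = S (B x)" by (simp flip: S_add)
    then have "S (B x - z *\<^sub>C x) = - x" by (simp add: SB S_scale)
    then show "(R \<circ> (\<lambda>x. B x - z *\<^sub>C x)) x = id x" by (simp add: R_def)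
  qed
  moreover have "(\<lambda>x. B x - z *\<^sub>C x) \<circ> R = id"
  proof
    fix x
    have "B (- S x) = - B (S x)" using bounded_clinearD(3)[OF B, of 0 "S x"] bounded_clinearD(4)[OF B] by simp
    then show "((\<lambda>x. B x - z *\<^sub>C x) \<circ> R) x = id x" by (simp add: R_def BS scaleC_minus_right)
  qed
  ultimately show ?thesis unfolding op_spectrum_def by blast
qed

text \<open>
  A kernel vector keeps the spectrum nonempty, so that its real supremum is meaningful.
\<close>

lemma op_spectral_radius_le:
  fixes B :: "'a::complex_banach \<Rightarrow> 'a"
  assumes B: "bounded_clinear B" and r: "r \<ge> 0" and C: "C \<ge> 0"
    and bound: "\<And>n x. norm ((B ^^ Suc n) x) \<le> C * r ^ n * norm x" and ker: "B v = 0" "v \<noteq> 0"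
  shows "op_spectral_radius B \<le> r"
  unfolding op_spectral_radius_def
proof (rule cSUP_least)
  have "0 \<in> op_spectrum B"
  proof (rule ccontr)
    assume "0 \<notin> op_spectrum B"
    then obtain R where R: "bounded_clinear R" "R \<circ> (\<lambda>x. B x - 0 *\<^sub>C x) = id"
      unfolding op_spectrum_def by blast
    have "R (B v - 0 *\<^sub>C v) = v" using fun_cong[OF R(2), of v] by simp
    then show False using ker bounded_clinearD(4)[OF R(1)] by simp
  qed
  then show "op_spectrum B \<noteq> {}" by blast
  show "cmod z \<le> r" if "z \<in> op_spectrum B" for z
    using neumann_resolvent[OF B r C bound] that by (meson not_le)
qed

section \<open>Geometrically convergent sequences\<close>

lemma geometric_Cauchy_limit:
  fixes h :: "nat \<Rightarrow> 'a::banach" and q :: real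
  assumes q: "0 \<le> q" "q < 1" and h: "\<And>n k. norm (h (n + k) - h n) \<le> C * q ^ n"
  obtains l where "h \<longlonglongrightarrow> l" "\<And>n. norm (h n - l) \<le> C * q ^ n"
proof -
  have "(\<lambda>n. C * q ^ n) \<longlonglongrightarrow> 0"
    using q by (intro tendsto_mult_right_zero LIMSEQ_power_zero) auto
  have "Cauchy h"
    unfolding Cauchy_altdef2
  proof (intro allI impI)
    fix e :: real assume "e > 0"
    then have "\<forall>\<^sub>F n in sequentially. C * q ^ n < e"
      by (rule order_tendstoD(2)[OF \<open>(\<lambda>n. C * q ^ n) \<longlonglongrightarrow> 0\<close>])
    then obtain N where N: "C * q ^ N < e" by (auto simp: eventually_sequentially)
    have "dist (h n) (h N) < e" if "n \<ge> N" for n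
      using h[of N "n - N"] that N by (simp add: dist_norm)
    then show "\<exists>N. \<forall>n\<ge>N. dist (h n) (h N) < e" by blast
  qed
  then obtain l where l: "h \<longlonglongrightarrow> l" by (auto simp: Cauchy_convergent_iff convergent_def)
  have "norm (h n - l) \<le> C * q ^ n" for n
  proof (rule Lim_bounded)
    show "(\<lambda>k. norm (h n - h (k + n))) \<longlonglongrightarrow> norm (h n - l)"
      by (intro tendsto_intros LIMSEQ_ignore_initial_segment[OF l])
    show "\<forall>k\<ge>0. norm (h n - h (k + n)) \<le> C * q ^ n"
      using h[of n] by (simp add: add.commute[of _ n] norm_minus_commute[of "h n"])
  qed
  then show ?thesis using that[OF l] by blast
qed

text \<open>
  The relative steps give \<open>\<parallel>h n\<parallel> \<le> \<parallel>h 0\<parallel> \<Prod>(1 + c q\<^sup>k)\<close>, and this product is bounded by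
  \<open>exp (c / (1 - q))\<close>; then the steps are absolutely geometric.
\<close>

lemma relative_geometric_steps_limit:
  fixes h :: "nat \<Rightarrow> 'a::banach" and q :: real
  assumes q: "0 \<le> q" "q < 1" and c: "c \<ge> 0"
    and step: "\<And>n. norm (h (Suc n) - h n) \<le> c * q ^ n * norm (h n)"
  obtains l B where "h \<longlonglongrightarrow> l" "B \<ge> 0" "\<And>n. norm (h n) \<le> B" "\<And>n. norm (h n - l) \<le> B * q ^ n"
proof -
  define B where "B = norm (h 0) * exp (c / (1 - q))"
  have B: "B \<ge> 0" by (simp add: B_def)
  have sum: "(\<Sum>k<n. q ^ k) \<le> 1 / (1 - q)" for n
    using q by (simp add: sum_gp_strict divide_right_mono)
  have "norm (h n) \<le> norm (h 0) * exp (c * (\<Sum>k<n. q ^ k))" for n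
  proof (induction n)
    case (Suc n)
    have "norm (h (Suc n)) \<le> norm (h n) + norm (h (Suc n) - h n)"
      using norm_triangle_ineq[of "h n" "h (Suc n) - h n"] by simp
    also have "\<dots> \<le> norm (h n) * (1 + c * q ^ n)"
      using step[of n] by (simp add: algebra_simps)
    also have "\<dots> \<le> (norm (h 0) * exp (c * (\<Sum>k<n. q ^ k))) * exp (c * q ^ n)"
      using Suc c q by (intro mult_mono) auto
    finally show ?case by (simp add: algebra_simps flip: exp_add)
  qed simp
  moreover have "norm (h 0) * exp (c * (\<Sum>k<n. q ^ k)) \<le> B" for n
    unfolding B_def using mult_left_mono[OF sum c, of n] by (intro mult_left_mono) auto
  ultimately have hB: "norm (h n) \<le> B" for n by (meson order_trans)
  define D where "D = c * B / (1 - q)"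
  have D: "D \<ge> 0" using c B q by (simp add: D_def)
  have "norm (h (n + k) - h n) \<le> D * (q ^ n - q ^ (n + k))" for n k
  proof (induction k)
    case (Suc k)
    have "norm (h (n + Suc k) - h n) \<le> norm (h (Suc (n + k)) - h (n + k)) + norm (h (n + k) - h n)"
      using norm_triangle_ineq[of "h (Suc (n + k)) - h (n + k)" "h (n + k) - h n"] by simp
    also have "norm (h (Suc (n + k)) - h (n + k)) \<le> c * q ^ (n + k) * B"
      using step[of "n + k"] mult_left_mono[OF hB[of "n + k"], of "c * q ^ (n + k)"] c q by simp
    also have "c * q ^ (n + k) * B = D * (q ^ (n + k) - q ^ (n + Suc k))"
      using q by (simp add: D_def field_simps)
    finally show ?case using Suc by (simp add: algebra_simps)
  qed simp
  moreover have "D * (q ^ n - q ^ (n + k)) \<le> D * q ^ n" for n k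
    using D q by (intro mult_left_mono) auto
  ultimately have "norm (h (n + k) - h n) \<le> D * q ^ n" for n k by (meson order_trans)
  from geometric_Cauchy_limit[OF q this]
  obtain l where l: "h \<longlonglongrightarrow> l" "\<And>n. norm (h n - l) \<le> D * q ^ n" by blast
  show ?thesis
  proof (rule that[OF l(1), of "max B D"])
    show "norm (h n) \<le> max B D" for n using hB[of n] by simp
    show "norm (h n - l) \<le> max B D * q ^ n" for n
      using l(2)[of n] mult_right_mono[of D "max B D" "q ^ n"] q by simp
  qed (use B in simp)
qed

section \<open>Two-by-two matrices and the right half-plane\<close>

text \<open>
  The denominator in \<open>Gamma_plus\<close>, as a function of the four entries. For equal rows it is
  \<open>2 Re (a cnj b)\<close>, so it polarizes the form that defines the complexified cone.
\<close>

definition pair_re :: "complex \<Rightarrow> complex \<Rightarrow> complex \<Rightarrow> complex \<Rightarrow> real" where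
  "pair_re a b c d = Re (a * cnj d + b * cnj c)"

text \<open>
  This identity makes the condition \<open>\<bar>a d - b c\<bar> \<le> Re (a cnj d + b cnj c)\<close> equivalent to
  \<open>(Im (a cnj d + b cnj c))\<^sup>2 \<le> 4 Re (a cnj b) Re (c cnj d)\<close> when the real part is nonnegative.
\<close>

lemma cmod_det_square:
  fixes a b c d :: complex
  shows "(cmod (a * d - b * c))\<^sup>2 =
    (cmod (a * cnj d + b * cnj c))\<^sup>2 - 4 * Re (a * cnj b) * Re (c * cnj d)"
  unfolding cmod_power2 by (simp add: power2_eq_square algebra_simps)

text \<open>
  The Hermitian form \<open>2 Re (Z1 cnj Z2)\<close> of the image \<open>(Z1, Z2)\<close> of \<open>(s, w)\<close>: a positive
  semidefinite form plus a term that is nonnegative for \<open>Re (s cnj w) \<ge> 0\<close>.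
\<close>

lemma image_pair_expansion:
  "2 * Re ((s * a + w * c) * cnj (s * b + w * d)) =
    2 * Re (a * cnj b) * (cmod s)\<^sup>2 + 2 * Re (c * cnj d) * (cmod w)\<^sup>2
      - 2 * Im (a * cnj d + b * cnj c) * Im (s * cnj w) + 2 * (pair_re a b c d * Re (s * cnj w))"
  unfolding cmod_power2 pair_re_def by (simp add: power2_eq_square algebra_simps)

text \<open>
  Ptolemy's inequality for the ratios of two functionals \<open>(s, t)\<close>, \<open>(s', t')\<close>, a point \<open>(p, q)\<close> and
  the mirror image of a point \<open>(p', q')\<close> in the imaginary axis, everything in homogeneous
  coordinates. Replacing the mirror image by the point itself increases the distance to any
  point of the left half-plane, where the zeros of the functionals lie.
\<close>

lemma ptolemy_right_half_plane:
  fixes s t s' t' p q p' q' :: complex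
  assumes "Re (s * cnj t) \<ge> 0" "Re (s' * cnj t') \<ge> 0" "Re (p' * cnj q') \<ge> 0"
  shows "cmod (s * t' - t * s') * cmod (p * cnj q' + q * cnj p')
    \<le> cmod ((s * p + t * q) * (s' * p' + t' * q')) + cmod ((s' * p + t' * q) * (s * p' + t * q'))"
proof -
  \<comment> \<open>The mirror image of \<open>(p', q')\<close> is \<open>(- cnj p', cnj q')\<close>.\<close>
  have refl: "cmod (t * cnj q' - s * cnj p') \<le> cmod (s * p' + t * q')"
    if "Re (s * cnj t) \<ge> 0" for s t :: complex
  proof -
    have "(cmod (s * p' + t * q'))\<^sup>2 - (cmod (t * cnj q' - s * cnj p'))\<^sup>2
        = 4 * (Re (s * cnj t) * Re (p' * cnj q'))"
      unfolding cmod_power2 by (simp add: power2_eq_square algebra_simps)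
    moreover have "4 * (Re (s * cnj t) * Re (p' * cnj q')) \<ge> 0" using that assms(3) by simp
    ultimately have "(cmod (t * cnj q' - s * cnj p'))\<^sup>2 \<le> (cmod (s * p' + t * q'))\<^sup>2" by linarith
    then show ?thesis by (rule power2_le_imp_le) simp
  qed
  have "cmod (s * t' - t * s') * cmod (p * cnj q' + q * cnj p')
      = cmod ((s * p + t * q) * (t' * cnj q' - s' * cnj p') - (s' * p + t' * q) * (t * cnj q' - s * cnj p'))"
    by (subst norm_mult[symmetric], rule arg_cong[of _ _ cmod], algebra)
  also have "\<dots> \<le> cmod (s * p + t * q) * cmod (t' * cnj q' - s' * cnj p')
      + cmod (s' * p + t' * q) * cmod (t * cnj q' - s * cnj p')"
    by (rule order_trans[OF norm_triangle_ineq4]) (simp add: norm_mult)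
  also have "\<dots> \<le> cmod (s * p + t * q) * cmod (s' * p' + t' * q')
      + cmod (s' * p + t' * q) * cmod (s * p' + t * q')"
    by (rule add_mono[OF mult_left_mono[OF refl[OF assms(2)]] mult_left_mono[OF refl[OF assms(1)]]]) simp_all
  finally show ?thesis by (simp add: norm_mult)
qed

text \<open>
  The Cauchy-Schwarz inequality for the positive semidefinite Hermitian form with diagonal
  \<open>2\<alpha>, 2\<beta>\<close> and off-diagonal entry \<open>\<i>\<tau>\<close>, with its defect: the product of two values is the
  squared modulus of the mixed value plus the Gram determinant.
\<close>

lemma hermitian_gram:
  fixes \<alpha> \<beta> \<tau> :: real and z w z' w' :: complex
  assumes "\<alpha> \<ge> 0" "\<beta> \<ge> 0" "\<tau>\<^sup>2 \<le> 4 * \<alpha> * \<beta>"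
  shows "(4 * \<alpha> * \<beta> - \<tau>\<^sup>2) * (cmod (z * w' - w * z'))\<^sup>2
    \<le> (2 * \<alpha> * (cmod z)\<^sup>2 + 2 * \<beta> * (cmod w)\<^sup>2 - 2 * \<tau> * Im (z * cnj w))
      * (2 * \<alpha> * (cmod z')\<^sup>2 + 2 * \<beta> * (cmod w')\<^sup>2 - 2 * \<tau> * Im (z' * cnj w'))" (is "?L \<le> ?G * ?G'")
    and "0 \<le> 2 * \<alpha> * (cmod z)\<^sup>2 + 2 * \<beta> * (cmod w)\<^sup>2 - 2 * \<tau> * Im (z * cnj w)" (is "0 \<le> ?G")
proof -
  let ?g = "2 * \<alpha> * z * cnj z' + 2 * \<beta> * w * cnj w' + \<i> * \<tau> * z * cnj w' - \<i> * \<tau> * w * cnj z'"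
  have G_eq: "complex_of_real (2 * \<alpha> * (cmod z)\<^sup>2 + 2 * \<beta> * (cmod w)\<^sup>2 - 2 * \<tau> * Im (z * cnj w))
      = 2 * \<alpha> * z * cnj z + 2 * \<beta> * w * cnj w + \<i> * \<tau> * (z * cnj w - w * cnj z)" for z w :: complex
    unfolding cmod_power2 by (simp add: complex_eq_iff power2_eq_square algebra_simps)
  have gram: "(2 * a * z * zc + 2 * b * w * wc + \<i> * t * (z * wc - w * zc))
      * (2 * a * z' * zc' + 2 * b * w' * wc' + \<i> * t * (z' * wc' - w' * zc'))
    = (4 * a * b - t\<^sup>2) * ((z * w' - w * z') * (zc * wc' - wc * zc'))
      + (2 * a * z * zc' + 2 * b * w * wc' + \<i> * t * z * wc' - \<i> * t * w * zc')
        * (2 * a * zc * z' + 2 * b * wc * w' - \<i> * t * zc * w' + \<i> * t * wc * z')"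
    for a b t z w z' w' zc wc zc' wc' :: complex
    by (simp add: power2_eq_square algebra_simps)
  have "complex_of_real ?G * complex_of_real ?G' = of_real (4 * \<alpha> * \<beta> - \<tau>\<^sup>2) * of_real ((cmod (z * w' - w * z'))\<^sup>2)
      + of_real ((cmod ?g)\<^sup>2)"
    unfolding G_eq complex_norm_square
    using gram[of "of_real \<alpha>" z "cnj z" "of_real \<beta>" w "cnj w" "of_real \<tau>" z' "cnj z'" w' "cnj w'"]
    by simp
  then have "complex_of_real (?G * ?G') = of_real (?L + (cmod ?g)\<^sup>2)"
    by (simp only: of_real_mult of_real_add)
  then have "?G * ?G' = ?L + (cmod ?g)\<^sup>2" by (simp only: of_real_eq_iff)
  then show "?L \<le> ?G * ?G'" by simp
  have "\<bar>\<tau> * Im (z * cnj w)\<bar> \<le> \<alpha> * (cmod z)\<^sup>2 + \<beta> * (cmod w)\<^sup>2"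
  proof (rule power2_le_imp_le)
    have "\<bar>\<tau> * Im (z * cnj w)\<bar>\<^sup>2 = \<tau>\<^sup>2 * (Im (z * cnj w))\<^sup>2" by (simp add: power_mult_distrib)
    also have "\<dots> \<le> (4 * \<alpha> * \<beta>) * (cmod (z * cnj w))\<^sup>2"
      using assms by (intro mult_mono) (auto simp: cmod_power2)
    also have "\<dots> = 4 * (\<alpha> * (cmod z)\<^sup>2) * (\<beta> * (cmod w)\<^sup>2)" by (simp add: norm_mult power_mult_distrib)
    also have "\<dots> \<le> (\<alpha> * (cmod z)\<^sup>2 + \<beta> * (cmod w)\<^sup>2)\<^sup>2" using zero_le_power2[of "\<alpha> * (cmod z)\<^sup>2 - \<beta> * (cmod w)\<^sup>2"]
      unfolding power2_sum power2_diff by linarith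
    finally show "\<bar>\<tau> * Im (z * cnj w)\<bar>\<^sup>2 \<le> (\<alpha> * (cmod z)\<^sup>2 + \<beta> * (cmod w)\<^sup>2)\<^sup>2" .
  qed (use assms in simp)
  then show "0 \<le> ?G" by linarith
qed

text \<open>
  Write \<open>X\<close>, \<open>Y\<close> for the two products in the conclusion. Then \<open>X - Y\<close> is the product of the three
  determinants, and it is enough to show \<open>\<bar>X - Y\<bar> \<le> \<theta> (\<bar>X\<bar> + \<bar>Y\<bar>)\<close>. The middle determinant is
  bounded by \<open>\<theta> \<sigma>\<close>; the other two, times \<open>\<sigma>\<close>, are bounded by \<open>\<bar>X\<bar> + \<bar>Y\<bar>\<close>, by Ptolemy for the
  functionals and by the Gram inequality for the vectors. In homogeneous coordinates no case of a
  vanishing denominator has to be excluded.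
\<close>

lemma cross_ratio_2x2:
  fixes a b c d s w s' w' m n m' n' :: complex and \<theta> :: real
  defines "Z1 \<equiv> s * a + w * c" and "Z2 \<equiv> s * b + w * d"
    and "Z1' \<equiv> s' * a + w' * c" and "Z2' \<equiv> s' * b + w' * d"
  assumes \<theta>: "0 \<le> \<theta>" "\<theta> \<le> 1"
    and ab: "Re (a * cnj b) \<ge> 0" and cd: "Re (c * cnj d) \<ge> 0" and pair0: "pair_re a b c d \<ge> 0"
    and det: "cmod (a * d - b * c) \<le> \<theta> * pair_re a b c d"
    and sw: "Re (s * cnj w) \<ge> 0" "Re (s' * cnj w') \<ge> 0"
    and mn: "Re (m * cnj n) \<ge> 0" "Re (m' * cnj n') \<ge> 0"
  shows "(1 - \<theta>) * cmod ((m * Z1 + n * Z2) * (m' * Z1' + n' * Z2'))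
    \<le> (1 + \<theta>) * cmod ((m' * Z1 + n' * Z2) * (m * Z1' + n * Z2'))"
proof -
  define \<alpha> \<beta> \<sigma> \<tau> where "\<alpha> = Re (a * cnj b)" and "\<beta> = Re (c * cnj d)"
    and "\<sigma> = pair_re a b c d" and "\<tau> = Im (a * cnj d + b * cnj c)"
  note defs = \<alpha>_def \<beta>_def \<sigma>_def \<tau>_def
  define G where "G s w = 2 * \<alpha> * (cmod s)\<^sup>2 + 2 * \<beta> * (cmod w)\<^sup>2 - 2 * \<tau> * Im (s * cnj w)" for s w :: complex
  have det2: "(cmod (a * d - b * c))\<^sup>2 = \<sigma>\<^sup>2 + \<tau>\<^sup>2 - 4 * \<alpha> * \<beta>"
    using cmod_det_square[of a d b c] by (simp add: defs pair_re_def cmod_power2)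
  have "cmod (a * d - b * c) \<le> \<sigma>"
    using det \<theta> pair0 mult_right_mono[of \<theta> 1 \<sigma>] by (simp add: \<sigma>_def)
  then have "(cmod (a * d - b * c))\<^sup>2 \<le> \<sigma>\<^sup>2" by (rule power_mono) simp
  then have \<tau>: "\<tau>\<^sup>2 \<le> 4 * \<alpha> * \<beta>" using det2 by simp
  have \<alpha>\<beta>: "\<alpha> \<ge> 0" "\<beta> \<ge> 0" using ab cd by (auto simp: defs)
  have diag: "2 * Re ((s * a + w * c) * cnj (s * b + w * d)) = G s w + 2 * (\<sigma> * Re (s * cnj w))" for s w :: complex
    unfolding G_def defs by (rule image_pair_expansion)
  have G_le: "G s w \<le> 2 * Re ((s * a + w * c) * cnj (s * b + w * d))" if "Re (s * cnj w) \<ge> 0" for s w :: complex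
    using diag[of s w] that pair0 by (simp add: \<sigma>_def)
  have G0: "0 \<le> G s w" for s w using hermitian_gram(2)[OF \<alpha>\<beta> \<tau>] by (simp add: G_def)
  have pos: "Re (Z1' * cnj Z2') \<ge> 0"
    using G_le[OF sw(2)] G0[of s' w'] by (simp add: Z1'_def Z2'_def)
  \<comment> \<open>The Gram inequality for the Hermitian form of \<open>(Z1, Z2)\<close>, whose determinant is \<open>- \<bar>a d - b c\<bar>\<^sup>2\<close>.\<close>
  have pair: "cmod (s * w' - w * s') * \<sigma> \<le> cmod (Z1 * cnj Z2' + Z2 * cnj Z1')"
  proof (rule power2_le_imp_le)
    have "(4 * \<alpha> * \<beta> - \<tau>\<^sup>2) * (cmod (s * w' - w * s'))\<^sup>2 \<le> G s w * G s' w'"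
      using hermitian_gram(1)[OF \<alpha>\<beta> \<tau>] by (simp add: G_def)
    also have "\<dots> \<le> (2 * Re (Z1 * cnj Z2)) * (2 * Re (Z1' * cnj Z2'))"
      unfolding Z1_def Z2_def Z1'_def Z2'_def
      using G_le[OF sw(1)] G_le[OF sw(2)] G0 order_trans[OF G0 G_le[OF sw(1)]] by (intro mult_mono)
    finally have 1: "(4 * \<alpha> * \<beta> - \<tau>\<^sup>2) * (cmod (s * w' - w * s'))\<^sup>2
      \<le> (2 * Re (Z1 * cnj Z2)) * (2 * Re (Z1' * cnj Z2'))" .
    have "Z1 * Z2' - Z2 * Z1' = (a * d - b * c) * (s * w' - w * s')"
      by (simp add: Z1_def Z2_def Z1'_def Z2'_def algebra_simps)
    then have 2: "(cmod (a * d - b * c))\<^sup>2 * (cmod (s * w' - w * s'))\<^sup>2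
        = (cmod (Z1 * cnj Z2' + Z2 * cnj Z1'))\<^sup>2 - 4 * Re (Z1 * cnj Z2) * Re (Z1' * cnj Z2')"
      using cmod_det_square[of Z1 Z2' Z2 Z1'] by (simp only: norm_mult power_mult_distrib)
    have "(cmod (s * w' - w * s') * \<sigma>)\<^sup>2
        = (cmod (a * d - b * c))\<^sup>2 * (cmod (s * w' - w * s'))\<^sup>2
          + (4 * \<alpha> * \<beta> - \<tau>\<^sup>2) * (cmod (s * w' - w * s'))\<^sup>2"
      unfolding det2 power_mult_distrib by (simp only: algebra_simps)
    with 1 2 show "(cmod (s * w' - w * s') * \<sigma>)\<^sup>2 \<le> (cmod (Z1 * cnj Z2' + Z2 * cnj Z1'))\<^sup>2"
      by linarith
  qed simp
  define X Y where "X = (m * Z1 + n * Z2) * (m' * Z1' + n' * Z2')"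
    and "Y = (m' * Z1 + n' * Z2) * (m * Z1' + n * Z2')"
  have "X - Y = (m * n' - n * m') * ((a * d - b * c) * (s * w' - w * s'))"
    by (simp add: X_def Y_def Z1_def Z2_def Z1'_def Z2'_def algebra_simps)
  then have "cmod (X - Y) = cmod (m * n' - n * m') * (cmod (a * d - b * c) * cmod (s * w' - w * s'))"
    by (simp add: norm_mult)
  also have "\<dots> \<le> cmod (m * n' - n * m') * ((\<theta> * \<sigma>) * cmod (s * w' - w * s'))"
    using det by (intro mult_left_mono mult_right_mono) (auto simp: \<sigma>_def)
  also have "\<dots> = \<theta> * (cmod (m * n' - n * m') * (cmod (s * w' - w * s') * \<sigma>))" by simp
  also have "\<dots> \<le> \<theta> * (cmod (m * n' - n * m') * cmod (Z1 * cnj Z2' + Z2 * cnj Z1'))"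
    using pair \<theta> by (intro mult_left_mono) auto
  also have "\<dots> \<le> \<theta> * (cmod X + cmod Y)"
    using ptolemy_right_half_plane[OF mn pos, of Z1 Z2] \<theta> unfolding X_def Y_def by (intro mult_left_mono) auto
  finally have "cmod (X - Y) \<le> \<theta> * (cmod X + cmod Y)" .
  then have "cmod X - cmod Y \<le> \<theta> * (cmod X + cmod Y)"
    using norm_triangle_ineq2[of X Y] by linarith
  then show ?thesis by (simp add: X_def Y_def algebra_simps)
qed

text \<open>
  A strict inequality for the determinant makes the semidefinite form of
  \<open>image_pair_expansion\<close> definite; completing the square shows it.
\<close>

lemma pos_pair_2x2:
  fixes a b c d s w :: complex
  assumes ab: "Re (a * cnj b) > 0" and det: "cmod (a * d - b * c) < pair_re a b c d"
    and sw: "Re (s * cnj w) \<ge> 0" "s \<noteq> 0"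
  shows "Re ((s * a + w * c) * cnj (s * b + w * d)) > 0"
proof -
  define \<alpha> \<beta> \<sigma> \<tau> where "\<alpha> = Re (a * cnj b)" and "\<beta> = Re (c * cnj d)"
    and "\<sigma> = pair_re a b c d" and "\<tau> = Im (a * cnj d + b * cnj c)"
  note defs = \<alpha>_def \<beta>_def \<sigma>_def \<tau>_def
  have det2: "(cmod (a * d - b * c))\<^sup>2 = \<sigma>\<^sup>2 + \<tau>\<^sup>2 - 4 * \<alpha> * \<beta>"
    using cmod_det_square[of a d b c] by (simp add: defs pair_re_def cmod_power2)
  have "(cmod (a * d - b * c))\<^sup>2 < \<sigma>\<^sup>2" using det by (intro power_strict_mono) (auto simp: \<sigma>_def)
  then have \<tau>: "\<tau>\<^sup>2 < 4 * \<alpha> * \<beta>" using det2 by simp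
  have \<alpha>: "\<alpha> > 0" using ab by (simp add: \<alpha>_def)
  define G where "G = 2 * \<alpha> * (cmod s)\<^sup>2 + 2 * \<beta> * (cmod w)\<^sup>2 - 2 * \<tau> * Im (s * cnj w)"
  have diag: "2 * Re ((s * a + w * c) * cnj (s * b + w * d)) = G + 2 * (\<sigma> * Re (s * cnj w))"
    unfolding G_def defs by (rule image_pair_expansion)
  have square: "2 * \<alpha> * G = (cmod (2 * \<alpha> * s - \<i> * \<tau> * w))\<^sup>2 + (4 * \<alpha> * \<beta> - \<tau>\<^sup>2) * (cmod w)\<^sup>2"
    unfolding G_def cmod_power2 by (simp add: power2_eq_square algebra_simps)
  have "2 * \<alpha> * G > 0"
  proof (cases "w = 0")
    case True
    then show ?thesis unfolding square using \<alpha> sw by simp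
  next
    case False
    then have "(4 * \<alpha> * \<beta> - \<tau>\<^sup>2) * (cmod w)\<^sup>2 > 0" using \<tau> by simp
    then show ?thesis unfolding square by (intro add_nonneg_pos) auto
  qed
  then have "G > 0" using \<alpha> by (simp add: zero_less_mult_iff)
  moreover have "\<sigma> \<ge> 0" using det norm_ge_zero[of "a * d - b * c"] unfolding \<sigma>_def by linarith
  then have "\<sigma> * Re (s * cnj w) \<ge> 0" using sw by (intro mult_nonneg_nonneg)
  ultimately show ?thesis using diag by linarith
qed

lemma mat2_eq_iff: "mat2 a b c d = mat2 a' b' c' d' \<longleftrightarrow> a = a' \<and> b = b' \<and> c = c' \<and> d = d'"
  by (auto simp: mat2_def vec_eq_iff forall_2)

lemma Gamma_plusD:
  assumes "mat2 a b c d \<in> Gamma_plus \<theta>"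
  shows "pair_re a b c d > 0" "cmod (a * d - b * c) \<le> \<theta> * pair_re a b c d"
proof -
  have *: "cmod (a * d - b * c) < pair_re a b c d" "cmod (a * d - b * c) / pair_re a b c d \<le> \<theta>"
    using assms by (auto simp: Gamma_plus_def Gamma_int_def mat2_eq_iff pair_re_def)
  then show pos: "pair_re a b c d > 0" using norm_ge_zero[of "a * d - b * c"] by linarith
  then show "cmod (a * d - b * c) \<le> \<theta> * pair_re a b c d" using *(2) by (simp add: field_simps)
qed

section \<open>Shrinking of oscillations in the plane\<close>

text \<open>
  For points \<open>w, p, q, w'\<close> in this order on a line at successive distances \<open>s, d, t\<close>, a bound
  \<open>\<rho>\<^sup>2\<close> on the cross-ratio bounds the proportion of the middle segment. The extremal case is
  \<open>s = t\<close>, so the arithmetic-geometric mean inequality enters.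
\<close>

lemma collinear_ratio_bound:
  fixes d s t \<rho> :: real
  assumes "d \<ge> 0" "s \<ge> 0" "t \<ge> 0" "\<rho> \<ge> 1" and le: "(d + s) * (d + t) \<le> \<rho>\<^sup>2 * (s * t)"
  shows "d \<le> (\<rho> - 1) / (\<rho> + 1) * (d + s + t)"
proof -
  have "4 * (s * t) = (s + t)\<^sup>2 - (s - t)\<^sup>2" by (simp add: power2_eq_square algebra_simps)
  then have amgm: "4 * (s * t) \<le> (s + t)\<^sup>2" by simp
  have "(2 * d + s + t)\<^sup>2 = 4 * ((d + s) * (d + t)) + ((s + t)\<^sup>2 - 4 * (s * t))"
    by (simp add: power2_eq_square algebra_simps)
  also have "\<dots> \<le> 4 * (\<rho>\<^sup>2 * (s * t)) + \<rho>\<^sup>2 * ((s + t)\<^sup>2 - 4 * (s * t))"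
    using le amgm assms mult_right_mono[of 1 "\<rho>\<^sup>2" "(s + t)\<^sup>2 - 4 * (s * t)"] by simp
  also have "\<dots> = (\<rho> * (s + t))\<^sup>2" unfolding power_mult_distrib by (simp add: algebra_simps)
  finally have "2 * d + s + t \<le> \<rho> * (s + t)"
    by (rule power2_le_imp_le) (use assms in auto)
  then show ?thesis using assms by (simp add: field_simps)
qed

text \<open>
  Only the line through \<open>p\<close> and \<open>q\<close> matters. Leaving \<open>G\<close> along it on both sides, one meets
  points \<open>w\<close>, \<open>w'\<close> outside \<open>G\<close> whose distance exceeds the bound \<open>D\<close> by an arbitrarily small
  amount. Looking at a line avoids comparing diameters with radii of circumscribed discs, which
  would cost a constant in every step.
\<close>

lemma oscillation_shrinks:
  fixes G :: "complex set" and \<rho> :: real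
  assumes G: "\<And>w w'. w \<in> G \<Longrightarrow> w' \<in> G \<Longrightarrow> cmod (w - w') \<le> D" and pq: "p \<in> G" "q \<in> G" and \<rho>: "\<rho> \<ge> 1"
    and cross: "\<And>w w'. w \<notin> G \<Longrightarrow> w' \<notin> G \<Longrightarrow>
      cmod (p - w') * cmod (q - w) \<le> \<rho>\<^sup>2 * (cmod (p - w) * cmod (q - w'))"
  shows "cmod (p - q) \<le> (\<rho> - 1) / (\<rho> + 1) * D"
proof (cases "p = q")
  case True
  then show ?thesis using G[OF pq] \<rho> by simp
next
  case False
  define \<eta> where "\<eta> = (\<rho> - 1) / (\<rho> + 1)"
  have \<eta>: "\<eta> \<ge> 0" using \<rho> by (simp add: \<eta>_def)
  define d where "d = cmod (p - q)"
  have d: "d > 0" using False by (simp add: d_def)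
  define u where "u = (q - p) / d"
  have u: "cmod u = 1" using False by (simp add: u_def d_def norm_divide norm_minus_commute)
  have q_eq: "q = p + d * u" using d by (simp add: u_def)
  have dist: "cmod z = \<bar>r\<bar>" if "z = of_real r * u" for r :: real and z
    using that by (simp add: norm_mult u)
  define S where "S = {s::real. s \<ge> 0 \<and> p - of_real s * u \<in> G}"
  have S_le: "s \<le> D - d" if "s \<in> S" for s :: real
  proof -
    have "q - (p - s * u) = of_real (d + s) * u" by (simp add: q_eq algebra_simps)
    from dist[OF this] have "cmod (q - (p - s * u)) = d + s" using that d by (simp add: S_def)
    then show ?thesis using G[OF pq(2), of "p - s * u"] that by (simp add: S_def)
  qed
  have S0: "0 \<in> S" using pq by (simp add: S_def)
  have bdd: "bdd_above S" using S_le by (meson bdd_aboveI)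
  have sup: "s \<le> Sup S" if "s \<in> S" for s by (rule cSup_upper[OF that bdd])
  have "d \<le> \<eta> * (D + e)" if e: "e > 0" for e
  proof -
    \<comment> \<open>The margin \<open>e\<close> is split between the two ends; then \<open>d + s + t = D + e\<close>.\<close>
    define s where "s = Sup S + e / 2"
    define t where "t = D - d - Sup S + e / 2"
    have "Sup S \<le> D - d" using S0 S_le by (intro cSup_least) auto
    then have t: "t > 0" using e by (simp add: t_def)
    have s: "s > 0" using sup[OF S0] e by (simp add: s_def)
    have w: "p - s * u \<notin> G" using sup[of s] e s by (auto simp: S_def s_def)
    have w': "q + t * u \<notin> G"
    proof
      assume *: "q + t * u \<in> G"
      have "x \<le> Sup S - e / 2" if x: "x \<in> S" for x
      proof -
        have "(q + t * u) - (p - x * u) = of_real (d + t + x) * u" by (simp add: q_eq algebra_simps)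
        from dist[OF this] have "cmod ((q + t * u) - (p - x * u)) = d + t + x" using x d t by (simp add: S_def)
        then show ?thesis using G[OF *, of "p - x * u"] x by (simp add: S_def t_def)
      qed
      then have "Sup S \<le> Sup S - e / 2" using S0 by (intro cSup_least) auto
      then show False using e by simp
    qed
    have 1: "p - (q + t * u) = of_real (- (d + t)) * u" "q - (p - s * u) = of_real (d + s) * u"
      "p - (p - s * u) = of_real s * u" "q - (q + t * u) = of_real (- t) * u"
      by (simp_all add: q_eq algebra_simps)
    have "cmod (p - (q + t * u)) = d + t" "cmod (q - (p - s * u)) = d + s"
      "cmod (p - (p - s * u)) = s" "cmod (q - (q + t * u)) = t"
      using 1[THEN dist] d s t by simp_all
    then have "(d + t) * (d + s) \<le> \<rho>\<^sup>2 * (s * t)" using cross[OF w w'] by simp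
    then have "d \<le> \<eta> * (d + s + t)"
      unfolding \<eta>_def using d s t \<rho> by (intro collinear_ratio_bound) (auto simp: mult.commute)
    then show ?thesis by (simp add: s_def t_def add.commute)
  qed
  then have "d \<le> \<eta> * D + e" if "e > 0" for e
  proof (cases "\<eta> = 0")
    case False
    then have "\<eta> > 0" using \<eta> by simp
    then show ?thesis using \<open>\<And>e. e > 0 \<Longrightarrow> d \<le> \<eta> * (D + e)\<close>[of "e / \<eta>"] that
      by (simp add: distrib_left)
  qed (use that d in force)
  then have "d \<le> \<eta> * D" by (rule field_le_epsilon)
  then show ?thesis by (simp add: d_def \<eta>_def)
qed

section \<open>Complexified spaces\<close>

locale complexified_space =
  fixes \<iota> :: "'r::banach \<Rightarrow> 'x::complex_banach"
  assumes complexification: "complexification \<iota>"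
begin

abbreviation mk :: "'r \<Rightarrow> 'r \<Rightarrow> 'x" where "mk x y \<equiv> \<iota> x + \<i> *\<^sub>C \<iota> y"

definition re :: "'x \<Rightarrow> 'r" where "re z = fst (parts \<iota> z)"
definition im :: "'x \<Rightarrow> 'r" where "im z = snd (parts \<iota> z)"

sublocale \<iota>: linear \<iota> using complexification by (simp add: complexification_def)

lemma norm_\<iota> [simp]: "norm (\<iota> x) = norm x"
  using complexification by (simp add: complexification_def)

lemma bounded_linear_\<iota>: "bounded_linear \<iota>"
  by (rule bounded_linear_intro[of _ 1]) (simp_all add: \<iota>.add \<iota>.scale)

lemma mk_re_im [simp]: "mk (re z) (im z) = z"
proof -
  have "surj (\<lambda>(x, y). mk x y)" using complexification by (simp add: complexification_def bij_is_surj)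
  from surj_f_inv_f[OF this, of z] show ?thesis by (simp add: re_def im_def parts_def split_beta)
qed

lemma re_im_mk [simp]: "re (mk x y) = x" "im (mk x y) = y"
proof -
  have "inj (\<lambda>(x, y). mk x y)" using complexification by (simp add: complexification_def bij_is_inj)
  from inv_f_f[OF this, of "(x, y)"] show "re (mk x y) = x" "im (mk x y) = y"
    by (simp_all add: re_def im_def parts_def)
qed

lemma re_im_\<iota> [simp]: "re (\<iota> x) = x" "im (\<iota> x) = 0"
  using re_im_mk[of x 0] by (simp_all add: \<iota>.zero)

lemma \<iota>_eq_0_iff [simp]: "\<iota> x = 0 \<longleftrightarrow> x = 0"
  using norm_\<iota>[of x] by (metis norm_eq_zero)

lemma scaleC_mk: "c *\<^sub>C mk x y = mk (Re c *\<^sub>R x - Im c *\<^sub>R y) (Im c *\<^sub>R x + Re c *\<^sub>R y)"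
proof -
  have "c *\<^sub>C mk x y = (of_real (Re c) + \<i> * of_real (Im c)) *\<^sub>C mk x y"
    by (simp flip: complex_eq)
  also have "\<dots> = Re c *\<^sub>R mk x y + \<i> *\<^sub>C (Im c *\<^sub>R mk x y)"
    by (simp only: scaleC_add_left scaleR_scaleC scaleC_scaleC)
  also have "\<dots> = Re c *\<^sub>R \<iota> x + \<i> *\<^sub>C (Re c *\<^sub>R \<iota> y) + (\<i> *\<^sub>C (Im c *\<^sub>R \<iota> x) - Im c *\<^sub>R \<iota> y)"
    by (simp add: scaleR_scaleC scaleC_scaleC scaleC_add_right mult.commute scaleC_minus_left
        flip: mult.assoc)
  also have "\<dots> = mk (Re c *\<^sub>R x - Im c *\<^sub>R y) (Im c *\<^sub>R x + Re c *\<^sub>R y)"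
    by (simp add: \<iota>.add \<iota>.diff \<iota>.scale scaleC_add_right)
  finally show ?thesis .
qed

lemma re_im_add: "re (z + z') = re z + re z'" "im (z + z') = im z + im z'"
proof -
  have "mk (re z + re z') (im z + im z') = mk (re z) (im z) + mk (re z') (im z')"
    by (simp only: \<iota>.add scaleC_add_right) (simp only: ac_simps)
  then have "z + z' = mk (re z + re z') (im z + im z')" by simp
  then show "re (z + z') = re z + re z'" "im (z + z') = im z + im z'" by (simp_all only: re_im_mk)
qed

lemma re_im_scaleC:
  "re (c *\<^sub>C z) = Re c *\<^sub>R re z - Im c *\<^sub>R im z" "im (c *\<^sub>C z) = Im c *\<^sub>R re z + Re c *\<^sub>R im z"
  using scaleC_mk[of c "re z" "im z"] re_im_mk by (simp_all only: mk_re_im)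

lemma cext_re_im: "cext \<iota> l z = complex_of_real (l (re z)) + \<i> * complex_of_real (l (im z))"
  by (simp add: cext_def re_def im_def)

lemma Re_Im_cext [simp]: "Re (cext \<iota> l z) = l (re z)" "Im (cext \<iota> l z) = l (im z)"
  by (simp_all add: cext_re_im)

lemma cext_\<iota> [simp]: "cext \<iota> l (\<iota> x) = of_real (l x)"
  by (simp add: complex_eq_iff)

lemma cext_add: "cext \<iota> l (z + z') = cext \<iota> l z + cext \<iota> l z'"
  by (simp add: complex_eq_iff re_im_add blinfun.add_right)

lemma cext_scaleC: "cext \<iota> l (c *\<^sub>C z) = c * cext \<iota> l z"
  by (simp add: complex_eq_iff re_im_scaleC blinfun.add_right blinfun.diff_right blinfun.scaleR_right)

text \<open>
  The bijection from the product of two copies of the real space is bounded, so its inverse is,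
  by the open mapping theorem. The norm of the complexification need not be invariant under
  conjugation, so the constant may exceed 1.
\<close>

lemma ex_bound_re_im: "\<exists>C\<ge>0. \<forall>z. norm (re z) \<le> C * norm z \<and> norm (im z) \<le> C * norm z"
proof -
  have "bounded_linear (\<lambda>(x, y). mk x y)"
    unfolding split_beta
    by (intro bounded_linear_add bounded_linear_compose[OF bounded_linear_scaleC_right]
        bounded_linear_compose[OF bounded_linear_\<iota>] bounded_linear_fst bounded_linear_snd)
  moreover have "surj (\<lambda>(x, y). mk x y)"
    using complexification by (simp add: complexification_def bij_is_surj)
  ultimately obtain C where C: "\<And>z. \<exists>p. (\<lambda>(x, y). mk x y) p = z \<and> norm p \<le> C * norm z"
    by (rule bounded_linear_surj_bounded_preimage) blast
  have "norm (re z) \<le> \<bar>C\<bar> * norm z \<and> norm (im z) \<le> \<bar>C\<bar> * norm z" for z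
  proof -
    obtain p where p: "mk (fst p) (snd p) = z" "norm p \<le> C * norm z"
      using C[of z] by (auto simp: split_beta)
    then have "re z = fst p" "im z = snd p" using re_im_mk by metis+
    moreover have "norm p \<le> \<bar>C\<bar> * norm z" using p(2) by (smt (verit) mult_right_mono norm_ge_zero)
    ultimately show ?thesis
      using norm_fst_le[of "fst p" "snd p"] norm_snd_le[of "snd p" "fst p"] by simp
  qed
  then show ?thesis by (intro exI[of _ "\<bar>C\<bar>"]) auto
qed

lemma bounded_clinear_cext: "bounded_clinear (cext \<iota> l)"
proof -
  obtain C where C: "C \<ge> 0" "\<And>z. norm (re z) \<le> C * norm z" "\<And>z. norm (im z) \<le> C * norm z"
    using ex_bound_re_im by blast
  show ?thesis
  proof (rule bounded_clinearI)
    fix z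
    have "cmod (cext \<iota> l z) \<le> \<bar>l (re z)\<bar> + \<bar>l (im z)\<bar>"
      using cmod_le[of "cext \<iota> l z"] by simp
    also have "\<dots> \<le> norm l * (C * norm z) + norm l * (C * norm z)"
      using order_trans[OF norm_blinfun[of l "re z"] mult_left_mono[OF C(2)[of z] norm_ge_zero[of l]]]
        order_trans[OF norm_blinfun[of l "im z"] mult_left_mono[OF C(3)[of z] norm_ge_zero[of l]]]
      by (intro add_mono) simp_all
    finally show "norm (cext \<iota> l z) \<le> 2 * norm l * C * norm z" by (simp add: mult_ac)
  qed (simp_all add: cext_add cext_scaleC scaleC_complex_def)
qed

end

section \<open>The complexified cone\<close>

text \<open>
  Once all values lie in the right half-plane, arguments differ by at most \<open>\<pi>\<close>, and an acute pairwise
  angle means a difference of at most \<open>\<pi>/2\<close>. So the infimum of the arguments is the right rotation.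
\<close>

lemma quadrant_of_half_plane:
  fixes V :: "complex set"
  assumes V: "\<And>a b. a \<in> V \<Longrightarrow> b \<in> V \<Longrightarrow> Re (a * cnj b) \<ge> 0"
    and half: "\<And>a. a \<in> V \<Longrightarrow> a \<noteq> 0 \<and> Re a \<ge> 0" and ne: "V \<noteq> {}"
  shows "\<exists>u. cmod u = 1 \<and> (\<forall>a\<in>V. Re (cnj u * a) \<ge> 0 \<and> Im (cnj u * a) \<ge> 0)"
proof -
  define k where "k = (INF a\<in>V. Arg a)"
  have Arg_half: "\<bar>Arg a\<bar> \<le> pi / 2" if "a \<in> V" for a
    using half[OF that] Arg_Re_nonneg[of a] by simp
  have polar: "a = of_real (cmod a) * cis (Arg a)" if "a \<in> V" for a
    using rcis_cmod_Arg[of a] by (simp add: rcis_def)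
  have diff: "Arg a - Arg b \<le> pi / 2" if ab: "a \<in> V" "b \<in> V" for a b
  proof (rule ccontr)
    assume "\<not> Arg a - Arg b \<le> pi / 2"
    then have "cos (Arg a - Arg b) < cos (pi / 2)"
      using Arg_half[OF ab(1)] Arg_half[OF ab(2)] by (intro cos_monotone_0_pi) (auto simp: abs_le_iff)
    moreover have "a * cnj b = of_real (cmod a * cmod b) * cis (Arg a - Arg b)"
      by (subst polar[OF ab(1)], subst polar[OF ab(2)]) (simp add: cis_cnj cis_mult mult_ac)
    then have "Re (a * cnj b) = cmod a * cmod b * cos (Arg a - Arg b)" by simp
    moreover have "cmod a * cmod b > 0" using half ab by simp
    ultimately show False using V[OF ab] by (simp add: zero_le_mult_iff)
  qed
  show ?thesis
  proof (intro exI[of _ "cis k"] conjI ballI)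
    fix a assume a: "a \<in> V"
    have "k \<le> Arg a" unfolding k_def
      by (rule cINF_lower[OF _ a]) (use Arg_half in \<open>force intro!: bdd_belowI2[of _ "- pi / 2"] simp: abs_le_iff\<close>)
    moreover have "Arg a - pi / 2 \<le> Arg b" if "b \<in> V" for b
      using diff[OF a that] by linarith
    then have "Arg a - pi / 2 \<le> k" unfolding k_def by (rule cINF_greatest[OF ne])
    moreover have "cnj (cis k) * a = of_real (cmod a) * cis (Arg a - k)"
      by (subst polar[OF a]) (simp add: cis_cnj cis_mult mult_ac)
    ultimately show "Re (cnj (cis k) * a) \<ge> 0" "Im (cnj (cis k) * a) \<ge> 0"
      by (auto intro!: mult_nonneg_nonneg cos_ge_zero sin_ge_zero)
  qed simp
qed

text \<open>
  Rotating one nonzero value to the positive axis reduces to the half-plane case.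
\<close>

lemma pairwise_acute_in_quadrant:
  fixes V :: "complex set"
  assumes V: "\<And>a b. a \<in> V \<Longrightarrow> b \<in> V \<Longrightarrow> Re (a * cnj b) \<ge> 0"
  obtains u where "cmod u = 1" "\<And>a. a \<in> V \<Longrightarrow> Re (cnj u * a) \<ge> 0 \<and> Im (cnj u * a) \<ge> 0"
proof (cases "V \<subseteq> {0}")
  case True
  then show ?thesis by (intro that[of 1]) auto
next
  case False
  then obtain b where b: "b \<in> V" "b \<noteq> 0" by auto
  \<comment> \<open>Rotation by \<open>cnj v\<close> takes \<open>b\<close> to the positive real axis.\<close>
  define v where "v = b / cmod b"
  have v: "cmod v = 1" using b by (simp add: v_def norm_divide)
  then have v1: "v * cnj v = 1" by (simp add: complex_norm_square[symmetric])
  have Re_v: "Re (cnj v * a) \<ge> 0" if "a \<in> V" for a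
  proof -
    have "cnj v * a = (a * cnj b) / of_real (cmod b)" by (simp add: v_def)
    then show ?thesis using V[OF that b(1)] by simp
  qed
  have "\<exists>u. cmod u = 1 \<and> (\<forall>a\<in>(\<lambda>a. cnj v * a) ` (V - {0}). Re (cnj u * a) \<ge> 0 \<and> Im (cnj u * a) \<ge> 0)"
  proof (rule quadrant_of_half_plane)
    fix a b assume "a \<in> (\<lambda>a. cnj v * a) ` (V - {0})" "b \<in> (\<lambda>a. cnj v * a) ` (V - {0})"
    then obtain a' b' where ab: "a' \<in> V" "b' \<in> V" "a = cnj v * a'" "b = cnj v * b'" by blast
    then have "a * cnj b = (v * cnj v) * (a' * cnj b')" by (simp add: mult_ac)
    then have "a * cnj b = a' * cnj b'" by (simp only: v1 mult_1)
    then show "Re (a * cnj b) \<ge> 0" using V[OF ab(1,2)] by (simp only:)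
  qed (use b Re_v v in auto)
  then obtain u where u: "cmod u = 1" "\<And>a. a \<in> V - {0} \<Longrightarrow> Re (cnj u * (cnj v * a)) \<ge> 0 \<and> Im (cnj u * (cnj v * a)) \<ge> 0"
    by auto
  show ?thesis
  proof (rule that[of "u * v"])
    show "cmod (u * v) = 1" using u v by (simp add: norm_mult)
    show "Re (cnj (u * v) * a) \<ge> 0 \<and> Im (cnj (u * v) * a) \<ge> 0" if "a \<in> V" for a
      using u(2)[of a] that by (cases "a = 0") (auto simp: mult_ac)
  qed
qed

lemma nonneg_span_subset_cone:
  assumes "0 \<in> C" "\<And>x y. x \<in> C \<Longrightarrow> y \<in> C \<Longrightarrow> x + y \<in> C" "\<And>t x. t \<ge> 0 \<Longrightarrow> x \<in> C \<Longrightarrow> t *\<^sub>R x \<in> C"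
    and "S \<subseteq> C"
  shows "nonneg_span S \<subseteq> C"
proof
  fix x assume "x \<in> nonneg_span S"
  then obtain n :: nat and t u where x: "x = (\<Sum>k<n. t k *\<^sub>R u k)" and tu: "\<forall>k<n. t k \<ge> 0 \<and> u k \<in> S"
    by (auto simp: nonneg_span_def)
  have "(\<Sum>k<j. t k *\<^sub>R u k) \<in> C" if "j \<le> n" for j
    using that by (induction j) (use tu assms in \<open>auto simp: subset_iff\<close>)
  then show "x \<in> C" using x by simp
qed

text \<open>
  The generating set \<open>M\<close> belongs to this setting because membership in both cones will be tested
  on \<open>M\<close> alone.
\<close>

locale complexified_cone_space = complexified_space \<iota>
  for \<iota> :: "'r::banach \<Rightarrow> 'x::complex_banach" +
  fixes K :: "'r set" and M :: "('r \<Rightarrow>\<^sub>L real) set"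
  assumes cone: "real_cone K" and wsg: "weak_star_generating_set \<iota> M K"
begin

abbreviation KC :: "'x set" where "KC \<equiv> complexified_cone \<iota> K"

abbreviation ev :: "('r \<Rightarrow>\<^sub>L real) \<Rightarrow> 'x \<Rightarrow> complex" where "ev \<equiv> cext \<iota>"

lemma closed_K: "closed K"
  using cone by (simp add: real_cone_def)

lemma K_zero: "0 \<in> K"
  using cone by (auto simp: real_cone_def)

lemma K_add: "x \<in> K \<Longrightarrow> y \<in> K \<Longrightarrow> x + y \<in> K"
  using cone by (auto simp: real_cone_def)

lemma K_scale: "t \<ge> 0 \<Longrightarrow> x \<in> K \<Longrightarrow> t *\<^sub>R x \<in> K"
  using cone unfolding real_cone_def by blast

lemma K_pointed: "x \<in> K \<Longrightarrow> - x \<in> K \<Longrightarrow> x = 0"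
proof -
  assume "x \<in> K" "- x \<in> K"
  then have "x \<in> K \<inter> uminus ` K" by (auto intro: rev_image_eqI)
  then show ?thesis using cone by (auto simp: real_cone_def)
qed

lemma M_nonneg: "m \<in> M \<Longrightarrow> x \<in> K \<Longrightarrow> m x \<ge> 0"
  using wsg by (auto simp: weak_star_generating_set_def dual_cone_def)

text \<open>
  Conditions that define a closed half-plane for the value at one point pass from \<open>M\<close> to its
  nonnegative span by linearity and to the whole dual cone by approximation at this point.
\<close>

lemma dual_value_in_half_plane:
  assumes l: "l \<in> dual_cone K" and M: "\<And>m. m \<in> M \<Longrightarrow> Re (ev m z * cnj b) \<ge> 0"
  shows "Re (ev l z * cnj b) \<ge> 0"
proof -
  define H where "H = {a. Re (a * cnj b) \<ge> 0}"
  define f where "f m = Re (ev m z * cnj b)" for m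
  have f: "f 0 = 0" "f (l + m) = f l + f m" "f (t *\<^sub>R l) = t * f l" for l m t
    by (simp_all add: f_def blinfun.add_left blinfun.scaleR_left algebra_simps)
  have fM: "f m \<ge> 0" if "m \<in> M" for m using M[OF that] by (simp only: f_def)
  have "nonneg_span M \<subseteq> {m. f m \<ge> 0}"
    by (rule nonneg_span_subset_cone) (use fM in \<open>auto simp: f\<close>)
  then have "(\<lambda>m. ev m z) ` nonneg_span M \<subseteq> H" unfolding f_def H_def by blast
  moreover have "\<exists>l'\<in>nonneg_span M. dist (ev l' z) (ev l z) < e" if "e > 0" for e
    using wsg l that unfolding weak_star_generating_set_def dist_norm
    by (metis finite.emptyI finite_insert insertI1)
  then have "ev l z \<in> closure ((\<lambda>m. ev m z) ` nonneg_span M)"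
    unfolding closure_approachable by blast
  moreover have "closed H" unfolding H_def by (intro closed_Collect_le continuous_intros)
  ultimately have "ev l z \<in> H" using closure_minimal by blast
  then show ?thesis by (simp only: H_def mem_Collect_eq)
qed

text \<open>
  The bipolar theorem: a point outside the closed cone is separated from it by an element of the
  dual cone, hence by an element of \<open>M\<close>.
\<close>

lemma K_iff: "x \<in> K \<longleftrightarrow> (\<forall>m\<in>M. m x \<ge> 0)"
proof
  assume R: "\<forall>m\<in>M. m x \<ge> 0"
  show "x \<in> K"
  proof (rule ccontr)
    assume "x \<notin> K"
    then obtain l :: "'r \<Rightarrow>\<^sub>L real" where l: "\<And>k. k \<in> K \<Longrightarrow> l k \<ge> 0" "l x < 0"
      using separating_functional_closed_cone[OF closed_K K_zero K_add K_scale] by blast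
    have "Re (ev l (\<iota> x) * cnj 1) \<ge> 0"
      by (rule dual_value_in_half_plane) (use l R in \<open>auto simp: dual_cone_def\<close>)
    then show False using l(2) by simp
  qed
qed (use M_nonneg in auto)

text \<open>
  The defining inequality is real-linear in each of the two functionals, so
  \<open>dual_value_in_half_plane\<close> applies to one of them at a time.
\<close>

lemma KC_iff: "z \<in> KC \<longleftrightarrow> (\<forall>m\<in>M. \<forall>m'\<in>M. Re (ev m z * cnj (ev m' z)) \<ge> 0)"
proof
  assume "z \<in> KC"
  then show "\<forall>m\<in>M. \<forall>m'\<in>M. Re (ev m z * cnj (ev m' z)) \<ge> 0"
    using wsg unfolding complexified_cone_def weak_star_generating_set_def by blast
next
  assume R: "\<forall>m\<in>M. \<forall>m'\<in>M. Re (ev m z * cnj (ev m' z)) \<ge> 0"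
  have sym: "Re (a * cnj b) = Re (b * cnj a)" for a b by (simp add: mult.commute)
  have *: "Re (ev l z * cnj (ev m z)) \<ge> 0" if "l \<in> dual_cone K" "m \<in> M" for l m
    by (rule dual_value_in_half_plane[OF that(1)]) (use that R in blast)
  have "Re (ev l z * cnj (ev l' z)) \<ge> 0" if "l \<in> dual_cone K" "l' \<in> dual_cone K" for l l'
  proof (rule dual_value_in_half_plane[OF that(1)])
    fix m assume "m \<in> M"
    then show "Re (ev m z * cnj (ev l' z)) \<ge> 0" by (subst sym) (rule *[OF that(2)])
  qed
  then show "z \<in> KC" unfolding complexified_cone_def by blast
qed

lemma KC_quadrant:
  assumes "z \<in> KC"
  obtains u x y where "cmod u = 1" "x \<in> K" "y \<in> K" "z = u *\<^sub>C mk x y"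
proof -
  have "\<exists>u. cmod u = 1 \<and> (\<forall>a\<in>(\<lambda>m. ev m z) ` M. Re (cnj u * a) \<ge> 0 \<and> Im (cnj u * a) \<ge> 0)"
    by (rule pairwise_acute_in_quadrant[of "(\<lambda>m. ev m z) ` M"]) (use assms KC_iff in blast)+
  then obtain u where u: "cmod u = 1" and
    quad: "\<And>m. m \<in> M \<Longrightarrow> Re (cnj u * ev m z) \<ge> 0 \<and> Im (cnj u * ev m z) \<ge> 0"
    by blast
  have "u * cnj u = 1" using u by (simp add: complex_norm_square[symmetric])
  then have "z = u *\<^sub>C (cnj u *\<^sub>C z)" by (simp add: scaleC_scaleC)
  moreover have "re (cnj u *\<^sub>C z) \<in> K" "im (cnj u *\<^sub>C z) \<in> K"
    using quad unfolding K_iff cext_scaleC[symmetric] Re_Im_cext by blast+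
  ultimately show ?thesis using that[OF u, of "re (cnj u *\<^sub>C z)" "im (cnj u *\<^sub>C z)"] by simp
qed

text \<open>
  In the decomposition of a nonzero point one real vector is nonzero; it is listed first and will
  serve as a pivot when two points are joined by a chain of real vectors.
\<close>

lemma KC_pivot:
  assumes "z \<in> KC" "z \<noteq> 0"
  obtains x y s w where "x \<in> K" "x \<noteq> 0" "y \<in> K" "Re (s * cnj w) \<ge> 0" "s \<noteq> 0"
    "z = s *\<^sub>C \<iota> x + w *\<^sub>C \<iota> y"
proof -
  obtain u x y where z: "cmod u = 1" "x \<in> K" "y \<in> K" "z = u *\<^sub>C mk x y"
    using KC_quadrant[OF assms(1)] .
  have z': "z = u *\<^sub>C \<iota> x + (\<i> * u) *\<^sub>C \<iota> y"
    unfolding z(4) by (simp add: scaleC_add_right scaleC_scaleC mult.commute)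
  show ?thesis
  proof (cases "x = 0")
    case False
    show ?thesis by (rule that[OF z(2) False z(3) _ _ z']) (use z(1) in auto)
  next
    case True
    then have "y \<noteq> 0" using assms(2) z by (auto simp: \<iota>.zero)
    then show ?thesis
      using z' z(1) by (intro that[OF z(3) _ z(2), of "\<i> * u" u]) (auto simp: add.commute)
  qed
qed

lemma KC_combine:
  assumes "x \<in> K" "y \<in> K" "Re (s * cnj w) \<ge> 0"
  shows "s *\<^sub>C \<iota> x + w *\<^sub>C \<iota> y \<in> KC"
  unfolding KC_iff
proof (intro ballI)
  fix m m' assume m: "m \<in> M" "m' \<in> M"
  have "Re (ev m (s *\<^sub>C \<iota> x + w *\<^sub>C \<iota> y) * cnj (ev m' (s *\<^sub>C \<iota> x + w *\<^sub>C \<iota> y)))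
    = m x * m' x * (cmod s)\<^sup>2 + m y * m' y * (cmod w)\<^sup>2 + (m x * m' y + m y * m' x) * Re (s * cnj w)"
    unfolding cmod_power2 by (simp add: cext_add cext_scaleC power2_eq_square algebra_simps)
  moreover have "m x * m' x * (cmod s)\<^sup>2 + m y * m' y * (cmod w)\<^sup>2 + (m x * m' y + m y * m' x) * Re (s * cnj w) \<ge> 0"
    using assms m M_nonneg by (intro add_nonneg_nonneg mult_nonneg_nonneg) auto
  ultimately show "Re (ev m (s *\<^sub>C \<iota> x + w *\<^sub>C \<iota> y) * cnj (ev m' (s *\<^sub>C \<iota> x + w *\<^sub>C \<iota> y))) \<ge> 0" by simp
qed

lemma combine_eq_0:
  assumes "x \<in> K" "y \<in> K" "Re w > 0" "\<iota> x + w *\<^sub>C \<iota> y = 0"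
  shows "x = 0" "y = 0"
proof -
  have "re (\<iota> x + w *\<^sub>C \<iota> y) = 0" by (simp only: assms(4)) (use re_im_\<iota>(1)[of 0] in \<open>simp add: \<iota>.zero\<close>)
  then have x: "x = - (Re w *\<^sub>R y)" by (simp add: re_im_add re_im_scaleC eq_neg_iff_add_eq_0)
  then show "x = 0" using assms K_pointed[of x] K_scale[of "Re w" y] by auto
  then show "y = 0" using x assms(3) by auto
qed

lemma KC_scaleC:
  assumes "z \<in> KC"
  shows "c *\<^sub>C z \<in> KC"
  unfolding KC_iff
proof (intro ballI)
  fix m m' assume m: "m \<in> M" "m' \<in> M"
  have "ev m (c *\<^sub>C z) * cnj (ev m' (c *\<^sub>C z)) = (c * cnj c) * (ev m z * cnj (ev m' z))"
    by (simp only: cext_scaleC complex_cnj_mult mult_ac)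
  also have "c * cnj c = of_real ((cmod c)\<^sup>2)" by (rule complex_norm_square[symmetric])
  finally have "Re (ev m (c *\<^sub>C z) * cnj (ev m' (c *\<^sub>C z))) = (cmod c)\<^sup>2 * Re (ev m z * cnj (ev m' z))"
    by (simp only: Re_complex_of_real times_complex.sel Im_complex_of_real)
  moreover have "Re (ev m z * cnj (ev m' z)) \<ge> 0" using assms m KC_iff by blast
  ultimately show "Re (ev m (c *\<^sub>C z) * cnj (ev m' (c *\<^sub>C z))) \<ge> 0"
    by (simp only: mult_nonneg_nonneg zero_le_power2)
qed

lemma \<iota>_in_KC: "x \<in> K \<Longrightarrow> \<iota> x \<in> KC"
  using KC_combine[of x 0 1 1] by (simp add: K_zero \<iota>.zero)

lemma closed_KC: "closed KC"
proof -
  have cont: "continuous_on UNIV (ev m)" for m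
    using bounded_clinearD(1)[OF bounded_clinear_cext] by (rule linear_continuous_on)
  have "closed {z. Re (ev m z * cnj (ev m' z)) \<ge> 0}" for m m'
    by (intro closed_Collect_le continuous_intros cont)
  then have "closed (\<Inter>m\<in>M. \<Inter>m'\<in>M. {z. Re (ev m z * cnj (ev m' z)) \<ge> 0})"
    by blast
  moreover have "KC = (\<Inter>m\<in>M. \<Inter>m'\<in>M. {z. Re (ev m z * cnj (ev m' z)) \<ge> 0})"
    by (rule set_eqI) (simp only: KC_iff INT_iff mem_Collect_eq)
  ultimately show ?thesis by (simp only:)
qed

text \<open>
  The hypothesis says \<open>e g \<plusminus> x \<in> K\<close>. If \<open>x\<close> and \<open>g\<close> span a plane, the aperture functional of this
  plane bounds both points, and hence their difference \<open>2 x\<close>; otherwise \<open>x\<close> is a multiple of \<open>g\<close>.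
\<close>

lemma norm_le_of_dominated:
  assumes ap: "bounded_sectional_aperture \<kappa> K" and \<kappa>: "\<kappa> \<ge> 0" and g: "g \<in> K"
    and e: "e \<ge> 0" and dom: "\<And>m. m \<in> M \<Longrightarrow> \<bar>m x\<bar> \<le> e * m g"
  shows "norm x \<le> max 1 \<kappa> * (e * norm g)"
proof (cases "x \<in> span {g}")
  case True
  then obtain c where c: "x = c *\<^sub>R g" by (auto simp: span_singleton)
  have "norm x \<le> e * norm g"
  proof (cases "g = 0")
    case False
    then have "- g \<notin> K" using K_pointed g by blast
    then obtain m where m: "m \<in> M" "m g > 0"
      unfolding K_iff by (auto simp: blinfun.minus_right not_le)
    have "\<bar>c\<bar> * m g \<le> e * m g"
      using dom[OF m(1)] m(2) by (simp add: c blinfun.scaleR_right abs_mult)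
    then have "\<bar>c\<bar> \<le> e" using m(2) by simp
    then show ?thesis by (simp add: c mult_right_mono)
  qed (simp add: c)
  also have "\<dots> \<le> max 1 \<kappa> * (e * norm g)"
    using mult_right_mono[of 1 "max 1 \<kappa>" "e * norm g"] e by simp
  finally show ?thesis .
next
  case False
  have pm: "e *\<^sub>R g + x \<in> K" "e *\<^sub>R g - x \<in> K"
    unfolding K_iff using dom
    by (fastforce simp: blinfun.add_right blinfun.diff_right blinfun.scaleR_right abs_le_iff)+
  have "g \<noteq> 0"
  proof
    assume "g = 0"
    then have "x \<in> K" "- x \<in> K" using pm by auto
    then have "x = 0" by (rule K_pointed)
    then show False using False span_zero by blast
  qed
  then have "independent {x, g}" using False by (simp add: independent_insert)
  moreover have "x \<noteq> g" using False span_base[of g "{g}"] by auto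
  ultimately have "dim (span {x, g}) = 2"
    by (simp add: dim_eq_card_independent)
  then obtain m :: "'r \<Rightarrow>\<^sub>L real" where m: "norm m = 1"
    "\<And>v. v \<in> K \<inter> span {x, g} \<Longrightarrow> norm v \<le> \<kappa> * m v"
    using ap unfolding bounded_sectional_aperture_def by blast
  have "e *\<^sub>R g + x \<in> span {x, g}" "e *\<^sub>R g - x \<in> span {x, g}"
    by (intro span_add span_diff span_scale span_base; simp)+
  then have "norm (e *\<^sub>R g + x) \<le> \<kappa> * m (e *\<^sub>R g + x)" "norm (e *\<^sub>R g - x) \<le> \<kappa> * m (e *\<^sub>R g - x)"
    using m(2) pm by auto
  moreover have "2 * norm x \<le> norm (e *\<^sub>R g + x) + norm (e *\<^sub>R g - x)"
  proof -
    have "(e *\<^sub>R g + x) - (e *\<^sub>R g - x) = 2 *\<^sub>R x" by (simp add: scaleR_2)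
    then show ?thesis using norm_triangle_ineq4[of "e *\<^sub>R g + x" "e *\<^sub>R g - x"] by simp
  qed
  ultimately have "norm x \<le> \<kappa> * (e * m g)"
    by (simp add: blinfun.add_right blinfun.diff_right blinfun.scaleR_right algebra_simps)
  also have "\<dots> \<le> max 1 \<kappa> * (e * norm g)"
  proof -
    have "m g \<le> norm g" using norm_blinfun[of m g] m(1) by simp
    then have "\<kappa> * (e * m g) \<le> \<kappa> * (e * norm g)" using \<kappa> e by (intro mult_left_mono) auto
    also have "\<dots> \<le> max 1 \<kappa> * (e * norm g)" using e by (intro mult_right_mono) auto
    finally show ?thesis .
  qed
  finally show ?thesis .
qed

text \<open>
  After a rotation \<open>y = a + \<i>b\<close> with \<open>a, b \<in> K\<close>, and \<open>\<bar>m y\<bar> \<le> m (a + b)\<close>. So real and imaginary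
  part of \<open>z\<close> are dominated by \<open>a + b\<close>, whose norm is controlled by that of \<open>y\<close>.
\<close>

lemma ex_norm_bound_of_dominated:
  assumes ap: "bounded_sectional_aperture \<kappa> K" and \<kappa>: "\<kappa> \<ge> 0"
  shows "\<exists>B\<ge>0. \<forall>z y e. y \<in> KC \<longrightarrow> e \<ge> 0 \<longrightarrow> (\<forall>m\<in>M. cmod (ev m z) \<le> e * cmod (ev m y))
    \<longrightarrow> norm z \<le> B * (e * norm y)"
proof -
  obtain C where C: "C \<ge> 0" "\<And>z. norm (re z) \<le> C * norm z" "\<And>z. norm (im z) \<le> C * norm z"
    using ex_bound_re_im by blast
  have "norm z \<le> (4 * max 1 \<kappa> * C) * (e * norm y)"
    if y: "y \<in> KC" and e: "e \<ge> 0" and dom: "\<forall>m\<in>M. cmod (ev m z) \<le> e * cmod (ev m y)" for z y e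
  proof -
    obtain u a b where u: "cmod u = 1" and ab: "a \<in> K" "b \<in> K" and y_eq: "y = u *\<^sub>C mk a b"
      using KC_quadrant[OF y] .
    have ey: "cmod (ev m y) \<le> m (a + b)" if "m \<in> M" for m
    proof -
      have "cmod (ev m y) = cmod (ev m (mk a b))" by (simp add: y_eq cext_scaleC norm_mult u)
      also have "\<dots> \<le> \<bar>m a\<bar> + \<bar>m b\<bar>" using cmod_le[of "ev m (mk a b)"] by simp
      finally show ?thesis using M_nonneg[OF that] ab by (simp add: blinfun.add_right)
    qed
    have "\<bar>m (re z)\<bar> \<le> e * m (a + b)" "\<bar>m (im z)\<bar> \<le> e * m (a + b)" if "m \<in> M" for m
      using abs_Re_le_cmod[of "ev m z"] abs_Im_le_cmod[of "ev m z"] bspec[OF dom that]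
        mult_left_mono[OF ey[OF that] e] by simp_all
    then have "norm (re z) \<le> max 1 \<kappa> * (e * norm (a + b))" "norm (im z) \<le> max 1 \<kappa> * (e * norm (a + b))"
      using norm_le_of_dominated[OF ap \<kappa> K_add[OF ab] e] by blast+
    moreover have "norm z \<le> norm (re z) + norm (im z)"
      using norm_triangle_ineq[of "\<iota> (re z)" "\<i> *\<^sub>C \<iota> (im z)"] by (simp add: norm_scaleC)
    ultimately have 1: "norm z \<le> 2 * max 1 \<kappa> * (e * norm (a + b))" by simp
    have "norm (mk a b) = norm y" by (simp add: y_eq norm_scaleC u)
    then have "norm (a + b) \<le> 2 * C * norm y"
      using C(2)[of "mk a b"] C(3)[of "mk a b"] norm_triangle_ineq[of a b] by simp
    then have "2 * max 1 \<kappa> * (e * norm (a + b)) \<le> 2 * max 1 \<kappa> * (e * (2 * C * norm y))"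
      using e by (intro mult_left_mono) auto
    with 1 show ?thesis by (simp add: mult_ac)
  qed
  then show ?thesis using C(1) by (intro exI[of _ "4 * max 1 \<kappa> * C"]) auto
qed

end

section \<open>Cross-ratios of images under the operator\<close>

locale cone_contraction = complexified_cone_space \<iota> K M
  for \<iota> :: "'r::banach \<Rightarrow> 'x::complex_banach" and K M +
  fixes E :: "'r set" and A :: "'x \<Rightarrow> 'x" and \<theta> :: real
  assumes A: "bounded_clinear A" and gen: "generating_set E K" and arch: "archimedian E K"
    and \<theta>0: "0 \<le> \<theta>" and \<theta>1: "\<theta> < 1"
    and transfer: "transfer_matrices \<iota> E M A \<subseteq> Gamma_plus \<theta>"
begin

definition evA :: "('r \<Rightarrow>\<^sub>L real) \<Rightarrow> 'x \<Rightarrow> complex" where "evA m z = ev m (A z)"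

definition cross_det where "cross_det m m' x y = evA m (\<iota> x) * evA m' (\<iota> y) - evA m' (\<iota> x) * evA m (\<iota> y)"

definition cross_pair where "cross_pair m m' x y = pair_re (evA m (\<iota> x)) (evA m' (\<iota> x)) (evA m (\<iota> y)) (evA m' (\<iota> y))"

lemma evA_add: "evA m (z + z') = evA m z + evA m z'"
  by (simp add: evA_def bounded_clinearD(2)[OF A] cext_add)

lemma evA_scaleC: "evA m (c *\<^sub>C z) = c * evA m z"
  by (simp add: evA_def bounded_clinearD(5)[OF A] cext_scaleC)

lemma evA_\<iota>_add: "evA m (\<iota> (x + y)) = evA m (\<iota> x) + evA m (\<iota> y)"
  by (simp add: \<iota>.add evA_add)

lemma evA_\<iota>_scale: "evA m (\<iota> (t *\<^sub>R x)) = t * evA m (\<iota> x)"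
  by (simp add: \<iota>.scale scaleR_scaleC evA_scaleC)

lemma bounded_linear_evA: "bounded_linear (evA m)"
  unfolding evA_def
  by (rule bounded_linear_compose[OF bounded_clinearD(1)[OF bounded_clinear_cext] bounded_clinearD(1)[OF A]])

lemma cross_pair_sym: "cross_pair m m' x y = cross_pair m m' y x" and cross_det_sym: "cmod (cross_det m m' x y) = cmod (cross_det m m' y x)"
proof -
  show "cross_pair m m' x y = cross_pair m m' y x" by (simp add: cross_pair_def pair_re_def algebra_simps)
  have "cross_det m m' x y = - cross_det m m' y x" by (simp add: cross_det_def algebra_simps)
  then show "cmod (cross_det m m' x y) = cmod (cross_det m m' y x)" by simp
qed

lemma cross_pair_add: "cross_pair m m' (x + x') y = cross_pair m m' x y + cross_pair m m' x' y"
  and cross_det_add: "cross_det m m' (x + x') y = cross_det m m' x y + cross_det m m' x' y"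
  by (simp_all add: cross_pair_def cross_det_def pair_re_def evA_\<iota>_add algebra_simps)

lemma cross_pair_scale: "cross_pair m m' (t *\<^sub>R x) y = t * cross_pair m m' x y"
  and cross_det_scale: "cross_det m m' (t *\<^sub>R x) y = t * cross_det m m' x y"
  by (simp_all add: cross_pair_def cross_det_def pair_re_def evA_\<iota>_scale algebra_simps)

lemma transfer_E:
  assumes "e \<in> E" "e' \<in> E" "m \<in> M" "m' \<in> M"
  shows "cross_pair m m' e e' > 0" "cmod (cross_det m m' e e') \<le> \<theta> * cross_pair m m' e e'"
proof -
  have "mat2 (evA m (\<iota> e)) (evA m' (\<iota> e)) (evA m (\<iota> e')) (evA m' (\<iota> e')) \<in> Gamma_plus \<theta>"
    using transfer assms unfolding transfer_matrices_def evA_def by blast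
  from Gamma_plusD[OF this] show "cross_pair m m' e e' > 0" "cmod (cross_det m m' e e') \<le> \<theta> * cross_pair m m' e e'"
    by (simp_all add: cross_pair_def cross_det_def)
qed

text \<open>
  The form of the matrix condition that survives limits: the strict inequalities are dropped.
\<close>

definition closed_Gamma where "closed_Gamma m m' x y \<longleftrightarrow> cross_pair m m' x y \<ge> 0 \<and> cmod (cross_det m m' x y) \<le> \<theta> * cross_pair m m' x y"

lemma closed_Gamma_sym: "closed_Gamma m m' x y = closed_Gamma m m' y x"
  by (simp add: closed_Gamma_def cross_pair_sym[of m m' x y] cross_det_sym[of m m' x y])

text \<open>
  For fixed \<open>y\<close> the condition has the form \<open>\<bar>L x\<bar> \<le> \<theta> R x\<close> with \<open>L\<close>, \<open>R\<close> real-linear, so it defines a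
  closed convex cone in \<open>x\<close>.
\<close>

lemma closed_Gamma_extends:
  assumes "\<And>e. e \<in> E \<Longrightarrow> closed_Gamma m m' e y" and "x \<in> K"
  shows "closed_Gamma m m' x y"
proof -
  let ?S = "{x. closed_Gamma m m' x y}"
  have cont: "continuous_on UNIV (\<lambda>x. evA m (\<iota> x))" for m
    by (rule linear_continuous_on[OF bounded_linear_compose[OF bounded_linear_evA bounded_linear_\<iota>]])
  have "closed ?S"
    unfolding closed_Gamma_def cross_pair_def cross_det_def pair_re_def
    by (intro closed_Collect_conj closed_Collect_le continuous_intros cont)
  moreover have "nonneg_span E \<subseteq> ?S"
  proof (rule nonneg_span_subset_cone)
    show "0 \<in> ?S" using cross_pair_scale[of m m' 0 0 y] cross_det_scale[of m m' 0 0 y] by (simp add: closed_Gamma_def)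
    fix u v assume "u \<in> ?S" "v \<in> ?S"
    then show "u + v \<in> ?S"
      using norm_triangle_ineq[of "cross_det m m' u y" "cross_det m m' v y"]
      by (auto simp: closed_Gamma_def cross_pair_add cross_det_add distrib_left)
  next
    fix t u assume "t \<ge> (0::real)" "u \<in> ?S"
    then show "t *\<^sub>R u \<in> ?S"
      using mult_left_mono[of "cmod (cross_det m m' u y)" "\<theta> * cross_pair m m' u y" t]
      by (auto simp: closed_Gamma_def cross_pair_scale cross_det_scale norm_mult algebra_simps)
  qed (use assms in auto)
  ultimately have "closure (nonneg_span E) \<subseteq> ?S" by (rule closure_minimal[rotated])
  then show ?thesis using assms(2) gen by (auto simp: generating_set_def)
qed

lemma closed_Gamma_K:
  assumes "m \<in> M" "m' \<in> M" "x \<in> K" "y \<in> K"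
  shows "cross_pair m m' x y \<ge> 0" "cmod (cross_det m m' x y) \<le> \<theta> * cross_pair m m' x y"
proof -
  have "closed_Gamma m m' e e'" if "e \<in> E" "e' \<in> E" for e e'
    using transfer_E[OF that assms(1,2)] by (simp add: closed_Gamma_def)
  then have "closed_Gamma m m' e y" if "e \<in> E" for e
    using closed_Gamma_extends[OF _ assms(4)] that closed_Gamma_sym by metis
  then have "closed_Gamma m m' x y" by (rule closed_Gamma_extends[OF _ assms(3)])
  then show "cross_pair m m' x y \<ge> 0" "cmod (cross_det m m' x y) \<le> \<theta> * cross_pair m m' x y" by (simp_all add: closed_Gamma_def)
qed

text \<open>
  This is where the Archimedian property enters: strict positivity on the generating set extends
  to nonzero points of the cone, because each of them dominates a positive multiple of a generator.
\<close>

lemma cross_pair_pos: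
  assumes m: "m \<in> M" "m' \<in> M" and x: "x \<in> K" "x \<noteq> 0" and y: "y \<in> K" "y \<noteq> 0"
  shows "cross_pair m m' x y > 0"
proof -
  have EK: "E \<subseteq> K" using gen by (auto simp: generating_set_def)
  obtain e t where e: "e \<in> E" "t > 0" "x - t *\<^sub>R e \<in> K"
    using arch x unfolding archimedian_def by blast
  obtain e' t' where e': "e' \<in> E" "t' > 0" "y - t' *\<^sub>R e' \<in> K"
    using arch y unfolding archimedian_def by blast
  have "cross_pair m m' y e = t' * cross_pair m m' e' e + cross_pair m m' (y - t' *\<^sub>R e') e"
    using cross_pair_add[of m m' "t' *\<^sub>R e'" "y - t' *\<^sub>R e'" e] by (simp add: cross_pair_scale)
  moreover have "t' * cross_pair m m' e' e > 0" using e' transfer_E(1)[OF e'(1) e(1) m] by simp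
  moreover have "cross_pair m m' (y - t' *\<^sub>R e') e \<ge> 0" using closed_Gamma_K(1)[OF m e'(3)] e EK by auto
  ultimately have "cross_pair m m' e y > 0" using cross_pair_sym[of m m' e y] by linarith
  then have "t * cross_pair m m' e y > 0" using e by simp
  moreover have "cross_pair m m' x y = t * cross_pair m m' e y + cross_pair m m' (x - t *\<^sub>R e) y"
    using cross_pair_add[of m m' "t *\<^sub>R e" "x - t *\<^sub>R e" y] by (simp add: cross_pair_scale)
  moreover have "cross_pair m m' (x - t *\<^sub>R e) y \<ge> 0" using closed_Gamma_K(1)[OF m e(3) y(1)] .
  ultimately show ?thesis by linarith
qed

lemma cross_pair_diag: "cross_pair m m' x x = 2 * Re (evA m (\<iota> x) * cnj (evA m' (\<iota> x)))"
  by (simp add: cross_pair_def pair_re_def algebra_simps)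

lemma evA_combine: "evA m (s *\<^sub>C \<iota> x + w *\<^sub>C \<iota> y) = s * evA m (\<iota> x) + w * evA m (\<iota> y)"
  by (simp add: evA_add evA_scaleC)

text \<open>
  In terms of \<open>KC_iff\<close>: \<open>A\<close> maps nonzero points of the complexified cone into this cone, with strict
  inequalities throughout.
\<close>

lemma evA_pos:
  assumes m: "m \<in> M" "m' \<in> M" and z: "z \<in> KC" "z \<noteq> 0"
  shows "Re (evA m z * cnj (evA m' z)) > 0"
proof -
  obtain x y s w where xy: "x \<in> K" "x \<noteq> 0" "y \<in> K" and sw: "Re (s * cnj w) \<ge> 0" "s \<noteq> 0"
    and z_eq: "z = s *\<^sub>C \<iota> x + w *\<^sub>C \<iota> y"
    using KC_pivot[OF z] .
  have xx: "Re (evA m (\<iota> x) * cnj (evA m' (\<iota> x))) > 0"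
    using cross_pair_pos[OF m xy(1,2) xy(1,2)] unfolding cross_pair_diag by linarith
  show ?thesis
  proof (cases "y = 0")
    case True
    have strict: "cmod (evA m (\<iota> x) * evA m' (\<iota> x) - evA m' (\<iota> x) * evA m (\<iota> x)) <
        pair_re (evA m (\<iota> x)) (evA m' (\<iota> x)) (evA m (\<iota> x)) (evA m' (\<iota> x))"
      using cross_pair_pos[OF m xy(1,2) xy(1,2)] by (simp add: cross_pair_def)
    have "z = s *\<^sub>C \<iota> x + 0 *\<^sub>C \<iota> x" using True by (simp add: z_eq \<iota>.zero)
    then have "evA k z = s * evA k (\<iota> x) + 0 * evA k (\<iota> x)" for k by (simp only: evA_combine)
    then show ?thesis using pos_pair_2x2[OF xx strict, of s 0] sw by (simp only:) simp
  next
    case False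
    have "cross_pair m m' x y > 0" by (rule cross_pair_pos[OF m xy False])
    then have "\<theta> * cross_pair m m' x y < cross_pair m m' x y" using \<theta>1 by simp
    then have "cmod (cross_det m m' x y) < cross_pair m m' x y" using closed_Gamma_K(2)[OF m xy(1,3)] by linarith
    then show ?thesis unfolding z_eq evA_combine cross_det_def cross_pair_def
      by (rule pos_pair_2x2[OF xx _ sw])
  qed
qed

text \<open>
  The complex functionals obtained from two real ones, pulled back by \<open>A\<close>. The complement of the
  complexified cone is filled by the kernels of such functionals, which is what makes them
  suitable for measuring the cone (\<open>pencils_kernel\<close>).
\<close>

definition pencils :: "('x \<Rightarrow> complex) set" where
  "pencils = {\<lambda>z. a * evA m z + b * evA m' z | a b m m'.
    m \<in> M \<and> m' \<in> M \<and> Re (a * cnj b) \<ge> 0 \<and> (a \<noteq> 0 \<or> b \<noteq> 0)}"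

lemma evA_in_pencils: "m \<in> M \<Longrightarrow> evA m \<in> pencils"
  unfolding pencils_def by (rule CollectI, rule exI[of _ 1], rule exI[of _ 0]) auto

text \<open>
  If \<open>a Z + b Z' = 0\<close> with \<open>a \<noteq> 0\<close>, then \<open>Z cnj Z'\<close> is a nonpositive multiple of \<open>b cnj a\<close>, whose real part is
  nonnegative.
\<close>

lemma pencils_nonzero:
  assumes f: "f \<in> pencils" and z: "z \<in> KC" "z \<noteq> 0"
  shows "f z \<noteq> 0"
proof
  assume f0: "f z = 0"
  obtain a b m m' where m: "m \<in> M" "m' \<in> M" and ab: "Re (a * cnj b) \<ge> 0" "a \<noteq> 0 \<or> b \<noteq> 0"
    and f_eq: "f = (\<lambda>z. a * evA m z + b * evA m' z)"
    using f unfolding pencils_def by blast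
  have pos: "Re (evA m z * cnj (evA m' z)) > 0" by (rule evA_pos[OF m z])
  have eq: "b * evA m' z = - (a * evA m z)" using f0 by (simp add: f_eq eq_neg_iff_add_eq_0 add.commute)
  have nz: "evA m z \<noteq> 0" "evA m' z \<noteq> 0" using pos by auto
  have "(cmod (evA m' z))\<^sup>2 * Re (a * cnj b) = Re (a * (evA m' z * cnj (b * evA m' z)))"
    unfolding cmod_power2 by (simp add: power2_eq_square algebra_simps)
  also have "\<dots> = - ((cmod a)\<^sup>2 * Re (evA m z * cnj (evA m' z)))"
    unfolding eq cmod_power2 by (simp add: power2_eq_square algebra_simps)
  finally have "(cmod a)\<^sup>2 * Re (evA m z * cnj (evA m' z)) \<le> 0"
    using ab(1) by (smt (verit) mult_nonneg_nonneg zero_le_power2)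
  then have "a = 0" using pos by (simp add: mult_le_0_iff)
  then show False using eq ab nz by simp
qed

definition cross_bound :: real where "cross_bound = (1 + \<theta>) / (1 - \<theta>)"

lemma cross_bound_ge_1: "cross_bound \<ge> 1"
  using \<theta>0 \<theta>1 by (simp add: cross_bound_def)

lemma cross_ratio_step:
  assumes m: "m \<in> M" "m' \<in> M" and xy: "x \<in> K" "y \<in> K"
    and sw: "Re (s * cnj w) \<ge> 0" "Re (s' * cnj w') \<ge> 0"
    and ab: "Re (a * cnj b) \<ge> 0" "Re (a' * cnj b') \<ge> 0"
    and f: "f = (\<lambda>z. a * evA m z + b * evA m' z)" and g: "g = (\<lambda>z. a' * evA m z + b' * evA m' z)"
    and z: "z = s *\<^sub>C \<iota> x + w *\<^sub>C \<iota> y" and z': "z' = s' *\<^sub>C \<iota> x + w' *\<^sub>C \<iota> y"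
  shows "cmod (f z * g z') \<le> cross_bound * cmod (g z * f z')"
proof -
  have *: "Re (evA m (\<iota> v) * cnj (evA m' (\<iota> v))) \<ge> 0" if "v \<in> K" for v
    using closed_Gamma_K(1)[OF m that that] unfolding cross_pair_diag by linarith
  have "(1 - \<theta>) * cmod (f z * g z') \<le> (1 + \<theta>) * cmod (g z * f z')"
    unfolding f g z z' evA_combine
    using cross_ratio_2x2[OF \<theta>0 less_imp_le[OF \<theta>1] *[OF xy(1)] *[OF xy(2)] _ _ sw ab]
      closed_Gamma_K[OF m xy] unfolding cross_pair_def cross_det_def by blast
  then show ?thesis using \<theta>1 by (simp add: cross_bound_def field_simps)
qed

text \<open>
  Cross-ratios multiply along a chain. Applied with the roles of vectors or of functionals it
  gives the triangle inequality in either argument.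
\<close>

lemma cross_ratio_trans:
  fixes a b c d e f :: complex
  assumes "cmod (a * d) \<le> k * cmod (c * b)" "cmod (b * f) \<le> l * cmod (d * e)" and "b \<noteq> 0" "d \<noteq> 0"
    and "k \<ge> 0"
  shows "cmod (a * f) \<le> k * l * cmod (c * e)"
proof -
  have "cmod (a * d) * cmod (b * f) \<le> (k * cmod (c * b)) * (l * cmod (d * e))"
    using assms by (intro mult_mono) auto
  then have "cmod (b * d) * cmod (a * f) \<le> cmod (b * d) * (k * l * cmod (c * e))"
    by (simp add: norm_mult mult_ac)
  then show ?thesis using assms by simp
qed

text \<open>
  The chain \<open>z, x, x', z'\<close> through the pivots of \<open>z\<close> and \<open>z'\<close>: consecutive members are complex
  combinations of a common pair of real vectors, so \<open>cross_ratio_step\<close> applies three times.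
\<close>

lemma cross_ratio_vectors:
  assumes m: "m \<in> M" "m' \<in> M" and f: "f \<in> pencils" "f = (\<lambda>z. a * evA m z + b * evA m' z)"
    and g: "g \<in> pencils" "g = (\<lambda>z. a' * evA m z + b' * evA m' z)"
    and ab: "Re (a * cnj b) \<ge> 0" "Re (a' * cnj b') \<ge> 0"
    and z: "z \<in> KC" "z \<noteq> 0" and z': "z' \<in> KC" "z' \<noteq> 0"
  shows "cmod (f z * g z') \<le> cross_bound ^ 3 * cmod (g z * f z')"
proof -
  obtain x y s w where xy: "x \<in> K" "x \<noteq> 0" "y \<in> K" and sw: "Re (s * cnj w) \<ge> 0" "s \<noteq> 0"
    and z_eq: "z = s *\<^sub>C \<iota> x + w *\<^sub>C \<iota> y"
    using KC_pivot[OF z] .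
  obtain x' y' s' w' where xy': "x' \<in> K" "x' \<noteq> 0" "y' \<in> K" and sw': "Re (s' * cnj w') \<ge> 0" "s' \<noteq> 0"
    and z'_eq: "z' = s' *\<^sub>C \<iota> x' + w' *\<^sub>C \<iota> y'"
    using KC_pivot[OF z'] .
  have x0: "\<iota> x \<in> KC" "\<iota> x \<noteq> 0" "\<iota> x' \<in> KC" "\<iota> x' \<noteq> 0" using xy xy' \<iota>_in_KC by auto
  note nz = pencils_nonzero[OF f(1) x0(1,2)] pencils_nonzero[OF f(1) x0(3,4)]
    pencils_nonzero[OF g(1) x0(1,2)] pencils_nonzero[OF g(1) x0(3,4)]
  have 1: "cmod (f z * g (\<iota> x)) \<le> cross_bound * cmod (g z * f (\<iota> x))"
    by (rule cross_ratio_step[OF m xy(1,3) sw(1) _ ab f(2) g(2) z_eq, of 1 0]) auto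
  have 2: "cmod (f (\<iota> x) * g (\<iota> x')) \<le> cross_bound * cmod (g (\<iota> x) * f (\<iota> x'))"
    by (rule cross_ratio_step[OF m xy(1) xy'(1) _ _ ab f(2) g(2), of 1 0 0 1]) auto
  have 3: "cmod (f (\<iota> x') * g z') \<le> cross_bound * cmod (g (\<iota> x') * f z')"
    by (rule cross_ratio_step[OF m xy'(1,3) _ sw'(1) ab f(2) g(2) _ z'_eq, of 1 0]) auto
  have "cmod (f z * g (\<iota> x')) \<le> cross_bound * cross_bound * cmod (g z * f (\<iota> x'))"
    using cross_bound_ge_1 by (intro cross_ratio_trans[OF 1 2] nz) auto
  from cross_ratio_trans[OF this 3] show ?thesis
    using nz cross_bound_ge_1 by (simp add: power3_eq_cube)
qed

text \<open>
  The same chain on the side of the functionals, \<open>f, m, m', g\<close>; each of its three steps costs the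
  third power of the elementary bound.
\<close>

lemma pencils_cross_ratio:
  assumes f: "f \<in> pencils" and g: "g \<in> pencils" and z: "z \<in> KC" "z \<noteq> 0" and z': "z' \<in> KC" "z' \<noteq> 0"
  shows "cmod (f z * g z') \<le> cross_bound ^ 9 * cmod (g z * f z')"
proof -
  obtain a b m n where m: "m \<in> M" "n \<in> M" and ab: "Re (a * cnj b) \<ge> 0"
    and f_eq: "f = (\<lambda>z. a * evA m z + b * evA n z)"
    using f unfolding pencils_def by blast
  obtain a' b' m' n' where m': "m' \<in> M" "n' \<in> M" and ab': "Re (a' * cnj b') \<ge> 0"
    and g_eq: "g = (\<lambda>z. a' * evA m' z + b' * evA n' z)"
    using g unfolding pencils_def by blast
  note fm = evA_in_pencils[OF m(1)] and fm' = evA_in_pencils[OF m'(1)]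
  note nz = pencils_nonzero[OF fm z] pencils_nonzero[OF fm z'] pencils_nonzero[OF fm' z] pencils_nonzero[OF fm' z']
  have 1: "cmod (f z * evA m z') \<le> cross_bound ^ 3 * cmod (evA m z * f z')"
    by (rule cross_ratio_vectors[OF m f f_eq fm _ ab _ z z', of 1 0]) auto
  have 2: "cmod (evA m z * evA m' z') \<le> cross_bound ^ 3 * cmod (evA m' z * evA m z')"
    by (rule cross_ratio_vectors[OF m(1) m'(1) fm _ fm' _ _ _ z z', of 1 0 0 1]) auto
  have 3: "cmod (evA m' z * g z') \<le> cross_bound ^ 3 * cmod (g z * evA m' z')"
    by (rule cross_ratio_vectors[OF m' fm' _ g g_eq _ ab' z z', of 1 0]) auto
  have "cmod (f z * evA m' z') \<le> cross_bound ^ 3 * cross_bound ^ 3 * cmod (evA m' z * f z')"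
    using cross_ratio_trans[of "f z" "evA m z'" "cross_bound ^ 3" "f z'" "evA m z" "evA m' z'" "cross_bound ^ 3" "evA m' z"] 1 2 nz cross_bound_ge_1
    by (simp add: mult.commute)
  then have "cmod (f z * g z') \<le> cross_bound ^ 3 * cross_bound ^ 3 * cross_bound ^ 3 * cmod (g z * f z')"
    using cross_ratio_trans[of "f z" "evA m' z'" "cross_bound ^ 3 * cross_bound ^ 3" "f z'" "evA m' z" "g z'" "cross_bound ^ 3" "g z"] 3 nz cross_bound_ge_1
    by (simp add: mult.commute)
  then show ?thesis by (simp flip: power_add)
qed

section \<open>Contraction of ratios\<close>

text \<open>
  The set of quotients \<open>f x / f y\<close>, written without division.
\<close>

definition ratios :: "'x \<Rightarrow> 'x \<Rightarrow> complex set" where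
  "ratios x y = {w. \<exists>f\<in>pencils. f x = w * f y}"

lemma pencils_linear:
  assumes "f \<in> pencils"
  shows "f (x + y) = f x + f y" "f (c *\<^sub>C x) = c * f x" "f (x - y) = f x - f y"
proof -
  obtain a b m m' where f: "f = (\<lambda>z. a * evA m z + b * evA m' z)" using assms unfolding pencils_def by blast
  show add: "f (x + y) = f x + f y" for x y by (simp add: f evA_add algebra_simps)
  show "f (c *\<^sub>C x) = c * f x" by (simp add: f evA_scaleC algebra_simps)
  show "f (x - y) = f x - f y" using add[of "x - y" y] by simp
qed

lemma A_minus_scaleC: "A (x - w *\<^sub>C y) = A x - w *\<^sub>C A y"
  by (simp add: bounded_clinearD[OF A])

text \<open>
  If \<open>Re (Z cnj Z') < 0\<close> for the values \<open>Z, Z'\<close> of two real functionals, then \<open>Z' m - Z m'\<close> kills the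
  point and its coefficients have the admissible angle.
\<close>

lemma pencils_kernel:
  assumes M: "M \<noteq> {}" and z: "A z \<notin> KC \<or> A z = 0"
  shows "\<exists>f\<in>pencils. f z = 0"
proof (cases "A z = 0")
  case True
  obtain m where m: "m \<in> M" using M by blast
  have "evA m z = 0" unfolding evA_def True by (simp add: bounded_clinearD(4)[OF bounded_clinear_cext])
  then show ?thesis using evA_in_pencils[OF m] by blast
next
  case False
  then obtain m m' where m: "m \<in> M" "m' \<in> M" and neg: "Re (evA m z * cnj (evA m' z)) < 0"
    using z unfolding KC_iff evA_def by (meson not_le)
  define f where "f = (\<lambda>v. evA m' z * evA m v + (- evA m z) * evA m' v)"
  have "Re (evA m' z * cnj (- evA m z)) = - Re (evA m z * cnj (evA m' z))" by simp
  then have "Re (evA m' z * cnj (- evA m z)) \<ge> 0" using neg by linarith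
  moreover have "evA m' z \<noteq> 0" using neg by auto
  ultimately have "f \<in> pencils" unfolding pencils_def f_def using m by blast
  moreover have "f z = 0" by (simp add: f_def)
  ultimately show ?thesis by blast
qed

lemma not_in_KC_imp_ratio:
  assumes M: "M \<noteq> {}" and w: "A x - w *\<^sub>C A y \<notin> KC - {0}"
  shows "w \<in> ratios x y"
proof -
  obtain f where f: "f \<in> pencils" "f (x - w *\<^sub>C y) = 0"
    using pencils_kernel[OF M, of "x - w *\<^sub>C y"] w by (auto simp: A_minus_scaleC)
  then have "f x = w * f y" by (simp add: pencils_linear[OF f(1)])
  then show ?thesis using f(1) by (auto simp: ratios_def)
qed

lemma ratios_imp_not_in_KC: "w \<in> ratios x y \<Longrightarrow> x - w *\<^sub>C y \<notin> KC - {0}"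
  using pencils_nonzero by (fastforce simp: ratios_def pencils_linear)

text \<open>
  The sets \<open>{w. x - w y \<notin> KC - {0}}\<close> interlace with the sets of ratios before and after an
  application of \<open>A\<close>; both inclusions come from duality between the cone and the pencils.
\<close>

lemma ratios_antimono: "M \<noteq> {} \<Longrightarrow> ratios (A x) (A y) \<subseteq> ratios x y"
  using not_in_KC_imp_ratio ratios_imp_not_in_KC by blast

lemma A_KC:
  assumes M: "M \<noteq> {}" and z: "z \<in> KC - {0}"
  shows "A z \<in> KC - {0}"
proof (rule ccontr)
  assume "A z \<notin> KC - {0}"
  then obtain f where "f \<in> pencils" "f z = 0" using pencils_kernel[OF M] by auto
  then show False using pencils_nonzero z by blast
qed

text \<open>
  The square root of the cross-ratio bound, so that \<open>eta1 \<theta> = (\<rho> - 1) / (\<rho> + 1)\<close>.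
\<close>

definition \<rho> :: real where "\<rho> = exp (9 * delta1 \<theta> / 2)"

lemma \<rho>_square: "\<rho>\<^sup>2 = cross_bound ^ 9"
proof -
  have cross_bound: "exp (delta1 \<theta>) = cross_bound" using \<theta>0 \<theta>1 by (simp add: delta1_def cross_bound_def)
  have "\<rho>\<^sup>2 = exp (real 9 * delta1 \<theta>)" by (simp add: \<rho>_def flip: exp_double)
  then show ?thesis by (simp only: exp_of_nat_mult cross_bound)
qed

lemma \<rho>_ge_1: "\<rho> \<ge> 1"
proof -
  have "delta1 \<theta> \<ge> 0" using cross_bound_ge_1 \<theta>0 \<theta>1 by (simp add: delta1_def cross_bound_def)
  then show ?thesis by (simp add: \<rho>_def)
qed

lemma eta1_eq: "eta1 \<theta> = (\<rho> - 1) / (\<rho> + 1)"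
proof -
  have "exp (- 2 * (9 * delta1 \<theta> / 4)) = inverse \<rho>" by (simp add: \<rho>_def flip: exp_minus)
  then have "eta1 \<theta> = (1 - inverse \<rho>) / (1 + inverse \<rho>)" unfolding eta1_def tanh_real_altdef by simp
  also have "\<dots> = ((\<rho> - 1) / \<rho>) / ((\<rho> + 1) / \<rho>)" using \<rho>_ge_1 by (simp add: diff_divide_distrib add_divide_distrib inverse_eq_divide)
  also have "\<dots> = (\<rho> - 1) / (\<rho> + 1)" using \<rho>_ge_1 by simp
  finally show ?thesis .
qed

lemma eta1_bounds: "0 \<le> eta1 \<theta>" "eta1 \<theta> < 1"
  using \<rho>_ge_1 by (simp_all add: eta1_eq)

text \<open>
  For \<open>w\<close> with \<open>z = A x - w A y\<close> a nonzero point of the cone, \<open>f z = (p - w) f (A y)\<close> if \<open>p\<close> is the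
  ratio belonging to \<open>f\<close>. So the cross-ratio bound for \<open>f, g\<close> and two such points is a cross-ratio
  bound for \<open>p, p', w, w'\<close>, as needed in \<open>oscillation_shrinks\<close>.
\<close>

lemma ratios_contraction:
  assumes M: "M \<noteq> {}" and y: "y \<in> KC - {0}"
    and D: "\<And>w w'. w \<in> ratios x y \<Longrightarrow> w' \<in> ratios x y \<Longrightarrow> cmod (w - w') \<le> D"
    and p: "p \<in> ratios (A x) (A y)" and p': "p' \<in> ratios (A x) (A y)"
  shows "cmod (p - p') \<le> eta1 \<theta> * D"
  unfolding eta1_eq
proof (rule oscillation_shrinks)
  let ?G = "{w. A x - w *\<^sub>C A y \<notin> KC - {0}}"
  show "cmod (w - w') \<le> D" if "w \<in> ?G" "w' \<in> ?G" for w w'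
    using that D not_in_KC_imp_ratio[OF M] by blast
  show "p \<in> ?G" "p' \<in> ?G" using p p' ratios_imp_not_in_KC by blast+
  show "\<rho> \<ge> 1" by (rule \<rho>_ge_1)
  obtain f where f: "f \<in> pencils" "f (A x) = p * f (A y)" using p by (auto simp: ratios_def)
  obtain g where g: "g \<in> pencils" "g (A x) = p' * g (A y)" using p' by (auto simp: ratios_def)
  have Ay: "A y \<in> KC - {0}" by (rule A_KC[OF M y])
  have nz: "f (A y) \<noteq> 0" "g (A y) \<noteq> 0" using pencils_nonzero f(1) g(1) Ay by auto
  fix w w' assume w: "w \<notin> ?G" "w' \<notin> ?G"
  have fg: "f (A x - v *\<^sub>C A y) = (p - v) * f (A y)" "g (A x - v *\<^sub>C A y) = (p' - v) * g (A y)" for v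
    by (simp_all add: pencils_linear[OF f(1)] pencils_linear[OF g(1)] f g algebra_simps)
  have "cmod (f (A x - w' *\<^sub>C A y) * g (A x - w *\<^sub>C A y))
      \<le> cross_bound ^ 9 * cmod (g (A x - w' *\<^sub>C A y) * f (A x - w *\<^sub>C A y))"
    by (rule pencils_cross_ratio[OF f(1) g(1)]) (use w in auto)
  then have "cmod (f (A y) * g (A y)) * (cmod (p - w') * cmod (p' - w))
      \<le> cmod (f (A y) * g (A y)) * (cross_bound ^ 9 * (cmod (p - w) * cmod (p' - w')))"
    unfolding fg by (simp add: norm_mult mult_ac)
  then show "cmod (p - w') * cmod (p' - w) \<le> \<rho>\<^sup>2 * (cmod (p - w) * cmod (p' - w'))"
    using nz by (simp add: \<rho>_square)
qed

lemma A_pow_KC: "M \<noteq> {} \<Longrightarrow> y \<in> KC - {0} \<Longrightarrow> (A ^^ n) y \<in> KC - {0}"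
proof (induction n)
  case (Suc n)
  then show ?case using A_KC[OF Suc.prems(1), of "(A ^^ n) y"] by simp
qed simp

lemma ratios_pow_antimono:
  assumes M: "M \<noteq> {}"
  shows "ratios ((A ^^ (n + k)) x) ((A ^^ (n + k)) y) \<subseteq> ratios ((A ^^ n) x) ((A ^^ n) y)"
proof (induction k)
  case (Suc k)
  show ?case using ratios_antimono[OF M, of "(A ^^ (n + k)) x" "(A ^^ (n + k)) y"] Suc by simp
qed simp

lemma ratios_pow_contraction:
  assumes M: "M \<noteq> {}" and y: "y \<in> KC - {0}"
    and D: "\<And>w w'. w \<in> ratios x y \<Longrightarrow> w' \<in> ratios x y \<Longrightarrow> cmod (w - w') \<le> D"
  shows "p \<in> ratios ((A ^^ n) x) ((A ^^ n) y) \<Longrightarrow> p' \<in> ratios ((A ^^ n) x) ((A ^^ n) y) \<Longrightarrow>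
    cmod (p - p') \<le> eta1 \<theta> ^ n * D"
proof (induction n arbitrary: p p')
  case (Suc n)
  have "cmod (p - p') \<le> eta1 \<theta> * (eta1 \<theta> ^ n * D)"
    by (rule ratios_contraction[OF M A_pow_KC[OF M y] Suc.IH]) (use Suc.prems in auto)
  then show ?case by simp
qed (use D in simp)

text \<open>
  On the real cone, comparing with one fixed functional bounds \<open>f x / f y\<close> uniformly in \<open>f\<close>. The
  reproducing property extends the bound to the real space, and the bounded decomposition into
  real and imaginary part to the whole space.
\<close>

lemma pencils_bound:
  assumes repr: "reproducing K" and M: "M \<noteq> {}" and y: "y \<in> KC - {0}"
  obtains C where "C \<ge> 0" "\<And>f x. f \<in> pencils \<Longrightarrow> cmod (f x) \<le> C * norm x * cmod (f y)"
proof -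
  obtain m where m: "m \<in> M" using M by blast
  note Fm = evA_in_pencils[OF m]
  have Fy: "evA m y \<noteq> 0" using pencils_nonzero[OF Fm] y by auto
  obtain B where B: "B \<ge> 0" "\<And>x. cmod (evA m x) \<le> B * norm x"
    using bounded_linear.nonneg_bounded[OF bounded_linear_evA, of m] by (auto simp: mult.commute)
  define c where "c = cross_bound ^ 9 * B / cmod (evA m y)"
  have c: "c \<ge> 0" using B(1) cross_bound_ge_1 by (simp add: c_def)
  have K: "cmod (f (\<iota> k)) \<le> c * norm k * cmod (f y)" if f: "f \<in> pencils" and k: "k \<in> K" for f k
  proof (cases "k = 0")
    case True
    then show ?thesis using pencils_linear(2)[OF f, of 0 0] by (simp add: \<iota>.zero)
  next
    case False
    have "cmod (f (\<iota> k) * evA m y) \<le> cross_bound ^ 9 * cmod (evA m (\<iota> k) * f y)"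
      by (rule pencils_cross_ratio[OF f Fm]) (use False k y \<iota>_in_KC in auto)
    also have "\<dots> \<le> cross_bound ^ 9 * (B * norm k * cmod (f y))"
      using B(2)[of "\<iota> k"] cross_bound_ge_1 unfolding norm_mult by (intro mult_left_mono mult_right_mono) auto
    finally show ?thesis using Fy by (simp add: c_def norm_mult field_simps)
  qed
  obtain g where g: "\<And>x. \<exists>k\<in>K. \<exists>k'\<in>K. x = k - k' \<and> norm k + norm k' \<le> g * norm x"
    using repr unfolding reproducing_def by blast
  have R: "cmod (f (\<iota> x)) \<le> c * \<bar>g\<bar> * norm x * cmod (f y)" if f: "f \<in> pencils" for f x
  proof -
    obtain k k' where k: "k \<in> K" "k' \<in> K" "x = k - k'" "norm k + norm k' \<le> g * norm x" using g by blast
    have "cmod (f (\<iota> x)) \<le> cmod (f (\<iota> k)) + cmod (f (\<iota> k'))"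
      using norm_triangle_ineq4 by (simp add: k(3) \<iota>.diff pencils_linear(3)[OF f])
    also have "\<dots> \<le> c * (norm k + norm k') * cmod (f y)"
      using K[OF f k(1)] K[OF f k(2)] by (simp add: algebra_simps)
    also have "\<dots> \<le> c * (\<bar>g\<bar> * norm x) * cmod (f y)"
      using k(4) c mult_right_mono[OF abs_ge_self[of g] norm_ge_zero[of x]]
      by (intro mult_left_mono mult_right_mono) auto
    finally show ?thesis by (simp add: mult_ac)
  qed
  obtain C where C: "C \<ge> 0" "\<And>z. norm (re z) \<le> C * norm z" "\<And>z. norm (im z) \<le> C * norm z"
    using ex_bound_re_im by blast
  show ?thesis
  proof (rule that)
    show "2 * c * \<bar>g\<bar> * C \<ge> 0" using c C(1) by simp
    fix f z assume f: "f \<in> pencils"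
    have "f z = f (\<iota> (re z)) + \<i> * f (\<iota> (im z))"
      by (subst mk_re_im[symmetric]) (simp only: pencils_linear[OF f])
    then have "cmod (f z) \<le> cmod (f (\<iota> (re z))) + cmod (f (\<iota> (im z)))"
      using norm_triangle_ineq[of "f (\<iota> (re z))" "\<i> * f (\<iota> (im z))"] by (simp add: norm_mult)
    also have "\<dots> \<le> c * \<bar>g\<bar> * (norm (re z) + norm (im z)) * cmod (f y)"
      using R[OF f, of "re z"] R[OF f, of "im z"] by (simp add: algebra_simps)
    also have "\<dots> \<le> c * \<bar>g\<bar> * (2 * C * norm z) * cmod (f y)"
      using C(2,3)[of z] c by (intro mult_left_mono mult_right_mono) auto
    finally show "cmod (f z) \<le> 2 * c * \<bar>g\<bar> * C * norm z * cmod (f y)" by (simp add: mult_ac)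
  qed
qed

section \<open>The leading functional, the eigenvector and the spectral gap\<close>

text \<open>
  The sets of ratios of \<open>A\<^sup>n x\<close> and \<open>A\<^sup>n y\<close> are nested and shrink geometrically to a point \<open>\<nu> x\<close>.
  Linearity and the eigenvalue equation pass to the limit from the quotients for one fixed
  functional; on the cone these quotients stay away from 0 by the cross-ratio bound.
\<close>

theorem leading_functional:
  assumes repr: "reproducing K" and M: "M \<noteq> {}" and y: "y \<in> KC - {0}"
  obtains \<nu> C where "bounded_clinear \<nu>" "\<nu> y = 1" "\<And>x. \<nu> (A x) = \<nu> (A y) * \<nu> x"
    "\<And>x. x \<in> KC - {0} \<Longrightarrow> \<nu> x \<noteq> 0" "C \<ge> 0"
    "\<And>n x m. m \<in> M \<Longrightarrow> cmod (evA m ((A ^^ n) x) - \<nu> x * evA m ((A ^^ n) y))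
      \<le> C * eta1 \<theta> ^ n * norm x * cmod (evA m ((A ^^ n) y))"
proof -
  obtain m0 where m0: "m0 \<in> M" using M by blast
  obtain C where C: "C \<ge> 0" "\<And>f x. f \<in> pencils \<Longrightarrow> cmod (f x) \<le> C * norm x * cmod (f y)"
    using pencils_bound[OF repr M y] by blast
  have fy: "f ((A ^^ n) y) \<noteq> 0" if "f \<in> pencils" for f n
    using pencils_nonzero[OF that] A_pow_KC[OF M y, of n] by auto
  have H_norm: "cmod w \<le> C * norm x" if "w \<in> ratios x y" for w x
  proof -
    obtain f where f: "f \<in> pencils" "f x = w * f y" using \<open>w \<in> ratios x y\<close> by (auto simp: ratios_def)
    have "cmod w * cmod (f y) \<le> C * norm x * cmod (f y)" using C(2)[OF f(1), of x] by (simp add: f(2) norm_mult)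
    then show ?thesis using fy[OF f(1), of 0] by simp
  qed
  have D: "cmod (w - w') \<le> 2 * C * norm x" if "w \<in> ratios x y" "w' \<in> ratios x y" for w w' x
    using norm_triangle_ineq4[of w w'] H_norm[OF that(1)] H_norm[OF that(2)] by simp
  define rr where "rr m n x = evA m ((A ^^ n) x) / evA m ((A ^^ n) y)" for m n x
  have rr_in_ratios: "rr m n x \<in> ratios ((A ^^ n) x) ((A ^^ n) y)" if "m \<in> M" for m n x
    unfolding ratios_def rr_def
    by (rule CollectI, rule bexI[OF _ evA_in_pencils[OF that]]) (use fy[OF evA_in_pencils[OF that], of n] in simp)
  have close: "cmod (rr m0 (n + k) x - p) \<le> eta1 \<theta> ^ n * (2 * C * norm x)"
    if "p \<in> ratios ((A ^^ n) x) ((A ^^ n) y)" for p n k x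
  proof (rule ratios_pow_contraction[OF M y, where D = "2 * C * norm x" and x = x and n = n])
    show "cmod (w - w') \<le> 2 * C * norm x" if "w \<in> ratios x y" "w' \<in> ratios x y" for w w'
      using that by (rule D)
    show "p \<in> ratios ((A ^^ n) x) ((A ^^ n) y)" by (rule that)
    show "rr m0 (n + k) x \<in> ratios ((A ^^ n) x) ((A ^^ n) y)"
      using rr_in_ratios[OF m0, of "n + k" x] ratios_pow_antimono[OF M, of n k x y] by blast
  qed
  have "\<exists>l. (\<lambda>n. rr m0 n x) \<longlonglongrightarrow> l" for x
    using geometric_Cauchy_limit[OF eta1_bounds, of "\<lambda>n. rr m0 n x" "2 * C * norm x"]
      close[OF rr_in_ratios[OF m0]] by (metis mult.commute)
  then obtain \<nu> where \<nu>: "\<And>x. (\<lambda>n. rr m0 n x) \<longlonglongrightarrow> \<nu> x" by metis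
  have \<nu>_close: "cmod (p - \<nu> x) \<le> eta1 \<theta> ^ n * (2 * C * norm x)"
    if "p \<in> ratios ((A ^^ n) x) ((A ^^ n) y)" for p n x
  proof (rule Lim_bounded)
    show "(\<lambda>k. cmod (p - rr m0 (k + n) x)) \<longlonglongrightarrow> cmod (p - \<nu> x)"
      by (intro tendsto_intros LIMSEQ_ignore_initial_segment[OF \<nu>])
    show "\<forall>k\<ge>0. cmod (p - rr m0 (k + n) x) \<le> eta1 \<theta> ^ n * (2 * C * norm x)"
      using close[OF that] by (simp add: add.commute[of _ n] norm_minus_commute[of p])
  qed
  have one: "\<nu> y = 1"
  proof (rule LIMSEQ_unique[OF \<nu>])
    have "rr m0 n y = 1" for n using fy[OF evA_in_pencils[OF m0]] by (simp add: rr_def)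
    then show "(\<lambda>n. rr m0 n y) \<longlonglongrightarrow> 1" by simp
  qed
  have eigen: "\<nu> (A x) = \<nu> (A y) * \<nu> x" for x
  proof (rule LIMSEQ_unique[OF \<nu>])
    have "rr m0 n (A x) = rr m0 n (A y) * rr m0 (Suc n) x" for n
      using fy[OF evA_in_pencils[OF m0], of n] fy[OF evA_in_pencils[OF m0], of "Suc n"]
      by (simp add: rr_def funpow_swap1)
    then show "(\<lambda>n. rr m0 n (A x)) \<longlonglongrightarrow> \<nu> (A y) * \<nu> x"
      by (auto intro!: tendsto_mult \<nu> LIMSEQ_Suc)
  qed
  have clinear: "bounded_clinear \<nu>"
  proof (rule bounded_clinearI)
    fix u v c
    show "\<nu> (u + v) = \<nu> u + \<nu> v"
    proof (rule LIMSEQ_unique[OF \<nu>])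
      show "(\<lambda>n. rr m0 n (u + v)) \<longlonglongrightarrow> \<nu> u + \<nu> v"
        using tendsto_add[OF \<nu> \<nu>] by (simp add: rr_def funpow_clinear[OF A] evA_add add_divide_distrib)
    qed
    show "\<nu> (c *\<^sub>C u) = c *\<^sub>C \<nu> u"
    proof (rule LIMSEQ_unique[OF \<nu>])
      show "(\<lambda>n. rr m0 n (c *\<^sub>C u)) \<longlonglongrightarrow> c *\<^sub>C \<nu> u"
        using tendsto_mult_left[OF \<nu>] by (simp add: rr_def funpow_clinear[OF A] evA_scaleC scaleC_complex_def)
    qed
    have p: "rr m0 0 u \<in> ratios u y" using rr_in_ratios[OF m0, of 0 u] by simp
    have "cmod (rr m0 0 u - \<nu> u) \<le> 2 * C * norm u" using \<nu>_close[of _ 0 u] p by simp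
    then show "norm (\<nu> u) \<le> 3 * C * norm u"
      using H_norm[OF p] norm_triangle_ineq2[of "\<nu> u" "rr m0 0 u"] by (simp add: norm_minus_commute)
  qed
  have nonzero: "\<nu> x \<noteq> 0" if x: "x \<in> KC - {0}" for x
  proof -
    \<comment> \<open>Comparing an arbitrary functional with \<open>m0\<close> gives a lower bound free of \<open>n\<close>.\<close>
    let ?c = "cmod (evA m0 x / evA m0 y) / cross_bound ^ 9"
    have "?c \<le> cmod (rr m0 n x)" for n
    proof -
      have "rr m0 n x \<in> ratios x y" using rr_in_ratios[OF m0, of n x] ratios_pow_antimono[OF M, of 0 n x y] by auto
      then obtain f where f: "f \<in> pencils" "f x = rr m0 n x * f y" by (auto simp: ratios_def)
      have "cmod (evA m0 x * f y) \<le> cross_bound ^ 9 * cmod (f x * evA m0 y)"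
        by (rule pencils_cross_ratio[OF evA_in_pencils[OF m0] f(1)]) (use x y in auto)
      then have "cmod (evA m0 x) * cmod (f y) \<le> (cross_bound ^ 9 * cmod (rr m0 n x) * cmod (evA m0 y)) * cmod (f y)"
        by (simp add: f(2) norm_mult mult_ac)
      then have "cmod (evA m0 x) \<le> cross_bound ^ 9 * cmod (rr m0 n x) * cmod (evA m0 y)"
        using fy[OF f(1), of 0] by simp
      then show ?thesis using fy[OF evA_in_pencils[OF m0], of 0] cross_bound_ge_1 by (simp add: norm_divide field_simps)
    qed
    then have "?c \<le> cmod (\<nu> x)"
      by (intro Lim_bounded2[OF tendsto_norm[OF \<nu>], of 0]) auto
    moreover have "evA m0 x \<noteq> 0" "evA m0 y \<noteq> 0" using pencils_nonzero[OF evA_in_pencils[OF m0]] x y by auto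
    then have "?c > 0" using cross_bound_ge_1 by simp
    ultimately show ?thesis by auto
  qed
  have estimate: "cmod (evA m ((A ^^ n) x) - \<nu> x * evA m ((A ^^ n) y))
      \<le> 2 * C * eta1 \<theta> ^ n * norm x * cmod (evA m ((A ^^ n) y))" if m: "m \<in> M" for m n x
  proof -
    have "evA m ((A ^^ n) x) - \<nu> x * evA m ((A ^^ n) y) = (rr m n x - \<nu> x) * evA m ((A ^^ n) y)"
      using fy[OF evA_in_pencils[OF m], of n] by (simp add: rr_def field_simps)
    then have "cmod (evA m ((A ^^ n) x) - \<nu> x * evA m ((A ^^ n) y)) = cmod (rr m n x - \<nu> x) * cmod (evA m ((A ^^ n) y))"
      by (simp add: norm_mult)
    also have "\<dots> \<le> eta1 \<theta> ^ n * (2 * C * norm x) * cmod (evA m ((A ^^ n) y))"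
      by (intro mult_right_mono \<nu>_close[OF rr_in_ratios[OF m]]) auto
    finally show ?thesis by (simp add: mult_ac)
  qed
  show ?thesis
    by (rule that[OF clinear one eigen nonzero _ estimate]) (use C(1) in simp_all)
qed

text \<open>
  If \<open>Re (\<nu> x cnj (\<nu> y)) < 0\<close>, then \<open>w = - \<nu> x / \<nu> y\<close> has positive real part, and \<open>\<nu>\<close> would vanish at
  the point \<open>x + w y\<close> of the cone.
\<close>

lemma nonvanishing_functional_in_dual_cone:
  assumes \<nu>: "bounded_clinear \<nu>" and nz: "\<And>x. x \<in> KC - {0} \<Longrightarrow> \<nu> x \<noteq> 0"
  shows "\<nu> \<in> complexified_dual_cone \<iota> K"
  unfolding complexified_dual_cone_def
proof (intro CollectI conjI \<nu> ballI)
  fix x y assume xy: "x \<in> K" "y \<in> K"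
  show "Re (\<nu> (\<iota> x) * cnj (\<nu> (\<iota> y))) \<ge> 0"
  proof (rule ccontr)
    assume neg: "\<not> Re (\<nu> (\<iota> x) * cnj (\<nu> (\<iota> y))) \<ge> 0"
    then have y0: "\<nu> (\<iota> y) \<noteq> 0" by auto
    define w where "w = - \<nu> (\<iota> x) / \<nu> (\<iota> y)"
    have "w = - (\<nu> (\<iota> x) * cnj (\<nu> (\<iota> y))) / of_real ((cmod (\<nu> (\<iota> y)))\<^sup>2)"
      unfolding w_def complex_norm_square using y0 by simp
    then have "Re w = - Re (\<nu> (\<iota> x) * cnj (\<nu> (\<iota> y))) / (cmod (\<nu> (\<iota> y)))\<^sup>2"
      by (simp only: Re_divide_of_real uminus_complex.sel)
    moreover have "(cmod (\<nu> (\<iota> y)))\<^sup>2 > 0" using y0 by simp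
    ultimately have w: "Re w > 0" using neg by (metis divide_pos_pos neg_0_less_iff_less not_le)
    define z where "z = \<iota> x + w *\<^sub>C \<iota> y"
    have "\<nu> z = 0"
      using y0 by (simp add: z_def bounded_clinearD[OF \<nu>] w_def scaleC_complex_def)
    moreover have "z \<in> KC" using KC_combine[of x y 1 w] xy w by (simp add: z_def)
    ultimately have "z = 0" using nz by blast
    then have "y = 0" using combine_eq_0[OF xy w] by (simp add: z_def)
    then show False using y0 by (simp add: \<iota>.zero bounded_clinearD(4)[OF \<nu>])
  qed
qed

theorem spectral_gap_exists:
  assumes nontriv: "\<exists>x::'r. x \<noteq> 0" and \<kappa>: "\<kappa> \<ge> 0" and ap: "bounded_sectional_aperture \<kappa> K"
    and repr: "reproducing K"
  shows "\<exists>l P. spectral_gap A l P \<and> eta_sp A l P \<le> eta1 \<theta> \<and>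
      (\<exists>h\<in>KC. \<exists>\<nu>\<in>complexified_dual_cone \<iota> K. \<exists>C::real.
        (\<forall>n\<ge>1. \<forall>x. norm (inverse (l ^ n) *\<^sub>C (A ^^ n) x - \<nu> x *\<^sub>C h)
                      \<le> C * eta1 \<theta> ^ (n - 1) * norm x) \<and>
        (\<forall>x\<in>KC - {0}. \<nu> x \<noteq> 0))"
proof -
  let ?\<eta> = "eta1 \<theta>"
  note \<eta> = eta1_bounds
  obtain k where k: "k \<in> K" "k \<noteq> 0"
    using nontriv repr unfolding reproducing_def by (metis diff_self)
  have M: "M \<noteq> {}"
  proof
    assume "M = {}"
    then have "- k \<in> K" unfolding K_iff by simp
    then show False using K_pointed k by blast
  qed
  define y where "y = \<iota> k"
  have y: "y \<in> KC - {0}" using k \<iota>_in_KC by (auto simp: y_def)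
  obtain \<nu> C where \<nu>: "bounded_clinear \<nu>" and \<nu>y: "\<nu> y = 1" and \<nu>A: "\<And>x. \<nu> (A x) = \<nu> (A y) * \<nu> x"
    and \<nu>_nz: "\<And>x. x \<in> KC - {0} \<Longrightarrow> \<nu> x \<noteq> 0" and C: "C \<ge> 0"
    and close_on_M: "\<And>n x m. m \<in> M \<Longrightarrow> cmod (evA m ((A ^^ n) x) - \<nu> x * evA m ((A ^^ n) y))
      \<le> C * ?\<eta> ^ n * norm x * cmod (evA m ((A ^^ n) y))"
    using leading_functional[OF repr M y] by blast
  define l where "l = \<nu> (A y)"
  have \<nu>l: "\<nu> (A x) = l * \<nu> x" for x unfolding l_def by (rule \<nu>A)
  have l: "l \<noteq> 0" unfolding l_def by (rule \<nu>_nz[OF A_KC[OF M y]])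
  obtain B where B: "B \<ge> 0" and dom: "\<And>z v e. v \<in> KC \<Longrightarrow> e \<ge> 0 \<Longrightarrow>
      \<forall>m\<in>M. cmod (ev m z) \<le> e * cmod (ev m v) \<Longrightarrow> norm z \<le> B * (e * norm v)"
    using ex_norm_bound_of_dominated[OF ap \<kappa>] by blast
  \<comment> \<open>Indexed from the first image on, since the functionals see a point only after one application of \<open>A\<close>; this is the shift in \<open>n - 1\<close>.\<close>
  define g where "g n = inverse (l ^ Suc n) *\<^sub>C (A ^^ Suc n) y" for n
  have gKC: "g n \<in> KC" for n unfolding g_def using A_pow_KC[OF M y, of "Suc n"] KC_scaleC by blast
  have close: "norm (inverse (l ^ Suc n) *\<^sub>C (A ^^ Suc n) x - \<nu> x *\<^sub>C g n)
      \<le> B * C * ?\<eta> ^ n * norm x * norm (g n)" for n x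
  proof -
    have "norm (inverse (l ^ Suc n) *\<^sub>C (A ^^ Suc n) x - \<nu> x *\<^sub>C g n) \<le> B * ((C * ?\<eta> ^ n * norm x) * norm (g n))"
    proof (rule dom[OF gKC])
      show "C * ?\<eta> ^ n * norm x \<ge> 0" using C \<eta> by simp
      show "\<forall>m\<in>M. cmod (ev m (inverse (l ^ Suc n) *\<^sub>C (A ^^ Suc n) x - \<nu> x *\<^sub>C g n))
          \<le> C * ?\<eta> ^ n * norm x * cmod (ev m (g n))"
      proof
        fix m assume m: "m \<in> M"
        have evA_iterate: "ev m ((A ^^ Suc n) v) = evA m ((A ^^ n) v)" for v by (simp add: evA_def)
        have "ev m (inverse (l ^ Suc n) *\<^sub>C (A ^^ Suc n) x - \<nu> x *\<^sub>C g n)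
            = inverse (l ^ Suc n) * (evA m ((A ^^ n) x) - \<nu> x * evA m ((A ^^ n) y))"
          unfolding g_def bounded_clinearD(3)[OF bounded_clinear_cext] cext_scaleC evA_iterate
          by (simp add: algebra_simps)
        then have "cmod (ev m (inverse (l ^ Suc n) *\<^sub>C (A ^^ Suc n) x - \<nu> x *\<^sub>C g n))
            = cmod (inverse (l ^ Suc n)) * cmod (evA m ((A ^^ n) x) - \<nu> x * evA m ((A ^^ n) y))"
          by (simp only: norm_mult)
        also have "\<dots> \<le> cmod (inverse (l ^ Suc n)) * (C * ?\<eta> ^ n * norm x * cmod (evA m ((A ^^ n) y)))"
          by (intro mult_left_mono close_on_M[OF m]) simp
        also have "\<dots> = C * ?\<eta> ^ n * norm x * cmod (ev m (g n))"
          unfolding g_def cext_scaleC evA_iterate norm_mult by (simp only: mult_ac)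
        finally show "cmod (ev m (inverse (l ^ Suc n) *\<^sub>C (A ^^ Suc n) x - \<nu> x *\<^sub>C g n))
            \<le> C * ?\<eta> ^ n * norm x * cmod (ev m (g n))" .
      qed
    qed
    then show ?thesis by (simp only: mult_ac)
  qed
  \<comment> \<open>The estimate for \<open>A y\<close>, since \<open>\<nu> (A y) = l\<close>.\<close>
  have step: "norm (g (Suc n) - g n) \<le> (B * C * norm (A y) / cmod l) * ?\<eta> ^ n * norm (g n)" for n
  proof -
    have "g (Suc n) - g n = inverse l *\<^sub>C (inverse (l ^ Suc n) *\<^sub>C (A ^^ Suc n) (A y) - \<nu> (A y) *\<^sub>C g n)"
    proof -
      have 1: "g (Suc n) = inverse l *\<^sub>C (inverse (l ^ Suc n) *\<^sub>C (A ^^ Suc n) (A y))"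
        by (simp add: g_def scaleC_scaleC funpow_swap1)
      have 2: "inverse l *\<^sub>C (l *\<^sub>C g n) = g n" using l by (simp add: scaleC_scaleC)
      show ?thesis unfolding l_def[symmetric] scaleC_diff_right 2 unfolding 1 ..
    qed
    then have "norm (g (Suc n) - g n) = inverse (cmod l) * norm (inverse (l ^ Suc n) *\<^sub>C (A ^^ Suc n) (A y) - \<nu> (A y) *\<^sub>C g n)"
      by (simp only: norm_scaleC norm_inverse)
    also have "\<dots> \<le> inverse (cmod l) * (B * C * ?\<eta> ^ n * norm (A y) * norm (g n))"
      by (intro mult_left_mono close) simp
    finally show ?thesis by (simp add: divide_inverse mult_ac)
  qed
  obtain h D where h: "g \<longlonglongrightarrow> h" and D: "D \<ge> 0" "\<And>n. norm (g n) \<le> D" "\<And>n. norm (g n - h) \<le> D * ?\<eta> ^ n"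
    using relative_geometric_steps_limit[OF \<eta> _ step] B C by auto
  have hKC: "h \<in> KC" using closed_sequentially[OF closed_KC] gKC h by blast
  have \<nu>pow: "\<nu> ((A ^^ n) y) = l ^ n" for n
    by (induction n) (simp_all add: \<nu>y \<nu>l)
  have \<nu>g: "\<nu> (g n) = 1" for n
  proof -
    have "l ^ Suc n \<noteq> 0" using l by simp
    then show ?thesis
      unfolding g_def bounded_clinearD(5)[OF \<nu>] \<nu>pow scaleC_complex_def by (rule left_inverse)
  qed
  have \<nu>h: "\<nu> h = 1"
    using bounded_linear.tendsto[OF bounded_clinearD(1)[OF \<nu>] h] by (simp add: \<nu>g LIMSEQ_const_iff)
  have h0: "h \<noteq> 0" using \<nu>h bounded_clinearD(4)[OF \<nu>] by auto
  have Ag: "A (g n) = l *\<^sub>C g (Suc n)" for n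
  proof -
    have 1: "l * inverse (l ^ Suc (Suc n)) = inverse (l ^ Suc n)" using l by simp
    have 2: "(A ^^ Suc (Suc n)) y = A ((A ^^ Suc n) y)" by simp
    show ?thesis unfolding g_def 2 bounded_clinearD(5)[OF A] scaleC_scaleC 1 ..
  qed
  have Ah: "A h = l *\<^sub>C h"
  proof (rule LIMSEQ_unique)
    show "(\<lambda>n. A (g n)) \<longlonglongrightarrow> A h" by (rule bounded_linear.tendsto[OF bounded_clinearD(1)[OF A] h])
    show "(\<lambda>n. A (g n)) \<longlonglongrightarrow> l *\<^sub>C h"
      unfolding Ag by (rule tendsto_scaleC_right[OF LIMSEQ_Suc[OF h]])
  qed
  obtain N where N: "N \<ge> 0" "\<And>x. cmod (\<nu> x) \<le> N * norm x"
    using bounded_linear.nonneg_bounded[OF bounded_clinearD(1)[OF \<nu>]] by (auto simp: mult.commute)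
  define Q where "Q = B * C * D + N * D"
  have Q: "Q \<ge> 0" using B C D(1) N(1) by (simp add: Q_def)
  \<comment> \<open>The error has two sources: \<open>x\<close> against \<open>y\<close>, and \<open>y\<close> against \<open>h\<close>.\<close>
  have main: "norm (inverse (l ^ Suc n) *\<^sub>C (A ^^ Suc n) x - \<nu> x *\<^sub>C h) \<le> Q * ?\<eta> ^ n * norm x" for n x
  proof -
    have "norm (inverse (l ^ Suc n) *\<^sub>C (A ^^ Suc n) x - \<nu> x *\<^sub>C h)
        \<le> norm (inverse (l ^ Suc n) *\<^sub>C (A ^^ Suc n) x - \<nu> x *\<^sub>C g n) + norm (\<nu> x *\<^sub>C (g n - h))"
      unfolding scaleC_diff_right by (rule norm_diff_triangle_le[OF order_refl order_refl])
    also have "\<dots> \<le> B * C * ?\<eta> ^ n * norm x * D + (N * norm x) * (D * ?\<eta> ^ n)"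
      unfolding norm_scaleC
    proof (intro add_mono mult_mono D N)
      have "B * C * ?\<eta> ^ n * norm x * norm (g n) \<le> B * C * ?\<eta> ^ n * norm x * D"
        using B C \<eta> by (intro mult_left_mono D) auto
      then show "norm (inverse (l ^ Suc n) *\<^sub>C (A ^^ Suc n) x - \<nu> x *\<^sub>C g n) \<le> B * C * ?\<eta> ^ n * norm x * D"
        using close[of n x] by linarith
    qed (use N(1) in auto)
    also have "\<dots> = Q * ?\<eta> ^ n * norm x" by (simp add: Q_def algebra_simps)
    finally show ?thesis .
  qed
  define P where "P x = \<nu> x *\<^sub>C h" for x
  have P: "bounded_clinear P"
  proof (rule bounded_clinearI)
    show "P (u + v) = P u + P v" "P (c *\<^sub>C u) = c *\<^sub>C P u" for u v c
      by (simp_all add: P_def bounded_clinearD[OF \<nu>] scaleC_add_left scaleC_scaleC scaleC_complex_def)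
    show "norm (P x) \<le> (N * norm h) * norm x" for x
      using mult_right_mono[OF N(2)[of x] norm_ge_zero[of h]] by (simp add: P_def norm_scaleC mult_ac)
  qed
  have AP: "A (P x) = l *\<^sub>C P x" and PA: "P (A x) = l *\<^sub>C P x" and PP: "P (P x) = P x" for x
    by (simp_all add: P_def bounded_clinearD(5)[OF A] bounded_clinearD(5)[OF \<nu>] Ah \<nu>l \<nu>h scaleC_scaleC
        scaleC_complex_def mult.commute)
  have proj: "one_dim_projection P"
    unfolding one_dim_projection_def
  proof (intro conjI P exI[of _ h] h0)
    show "P \<circ> P = P" by (simp add: fun_eq_iff PP)
    have "c *\<^sub>C h = P (c *\<^sub>C h)" for c by (simp add: P_def bounded_clinearD(5)[OF \<nu>] \<nu>h scaleC_complex_def)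
    then show "range P = range (\<lambda>c. c *\<^sub>C h)" unfolding P_def by blast
  qed
  define T where "T x = A x - l *\<^sub>C P x" for x
  have T: "bounded_clinear T"
    unfolding bounded_clinear_def T_def
    by (intro conjI bounded_linear_sub bounded_clinearD(1)[OF A]
        bounded_linear_compose[OF bounded_linear_scaleC_right bounded_clinearD(1)[OF P]])
      (simp add: bounded_clinearD[OF A] bounded_clinearD[OF P] scaleC_diff_right scaleC_scaleC mult.commute)
  have T_pow: "(T ^^ Suc n) x = (A ^^ Suc n) x - l ^ Suc n *\<^sub>C P x" for n x
  proof (induction n)
    case (Suc n)
    have "P ((A ^^ k) x) = l ^ k *\<^sub>C P x" for k by (induction k) (simp_all add: PA scaleC_scaleC)
    from this[of "Suc n"] have "P ((T ^^ Suc n) x) = 0"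
      unfolding Suc bounded_clinearD(3)[OF P] bounded_clinearD(5)[OF P] PP by simp
    then have "T ((T ^^ Suc n) x) = A ((T ^^ Suc n) x)" by (simp add: T_def)
    also have "\<dots> = (A ^^ Suc (Suc n)) x - l ^ Suc (Suc n) *\<^sub>C P x"
      unfolding Suc by (simp add: bounded_clinearD[OF A] AP scaleC_scaleC mult.commute)
    finally show ?case by simp
  qed (simp add: T_def)
  have T_norm: "norm ((T ^^ Suc n) x) \<le> (Q * cmod l) * (?\<eta> * cmod l) ^ n * norm x" for n x
  proof -
    have "(T ^^ Suc n) x = l ^ Suc n *\<^sub>C (inverse (l ^ Suc n) *\<^sub>C (A ^^ Suc n) x - \<nu> x *\<^sub>C h)"
    proof -
      have "l ^ Suc n \<noteq> 0" using l by simp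
      then have "l ^ Suc n * inverse (l ^ Suc n) = 1" by (rule right_inverse)
      then show ?thesis unfolding T_pow P_def scaleC_diff_right scaleC_scaleC by (simp only: scaleC_one)
    qed
    then have "norm ((T ^^ Suc n) x) = cmod l ^ Suc n * norm (inverse (l ^ Suc n) *\<^sub>C (A ^^ Suc n) x - \<nu> x *\<^sub>C h)"
      by (simp only: norm_scaleC norm_power)
    also have "\<dots> \<le> cmod l ^ Suc n * (Q * ?\<eta> ^ n * norm x)" by (intro mult_left_mono main) simp
    finally show ?thesis by (simp add: power_mult_distrib mult_ac)
  qed
  have radius: "op_spectral_radius T \<le> ?\<eta> * cmod l"
  proof (rule op_spectral_radius_le[OF T _ _ T_norm _ h0])
    show "T h = 0" by (simp add: T_def P_def \<nu>h Ah)
  qed (use \<eta> Q in auto)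
  have "?\<eta> * cmod l < cmod l" using \<eta> l by simp
  then have "op_spectral_radius (\<lambda>x. A x - l *\<^sub>C P x) < cmod l"
    using radius unfolding T_def by linarith
  then have "spectral_gap A l P"
    unfolding spectral_gap_def by (intro conjI allI exI[of _ h] l h0 Ah proj AP PA)
  moreover have "eta_sp A l P \<le> ?\<eta>"
    using radius l unfolding eta_sp_def T_def by (simp add: pos_divide_le_eq)
  moreover have "\<forall>n\<ge>1. \<forall>x. norm (inverse (l ^ n) *\<^sub>C (A ^^ n) x - \<nu> x *\<^sub>C h) \<le> Q * ?\<eta> ^ (n - 1) * norm x"
  proof (intro allI impI)
    fix n :: nat and x assume "n \<ge> 1"
    then obtain k where "n = Suc k" by (cases n) auto
    then show "norm (inverse (l ^ n) *\<^sub>C (A ^^ n) x - \<nu> x *\<^sub>C h) \<le> Q * ?\<eta> ^ (n - 1) * norm x"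
      using main[of k x] by (simp only: diff_Suc_1)
  qed
  moreover have "\<forall>x\<in>KC - {0}. \<nu> x \<noteq> 0" using \<nu>_nz by blast
  ultimately show ?thesis using hKC nonvanishing_functional_in_dual_cone[OF \<nu> \<nu>_nz] by blast
qed

end

theorem theorem2p10:
  fixes \<iota> :: "'r::banach \<Rightarrow> 'x::complex_banach"
    and A :: "'x \<Rightarrow> 'x"
    and K E :: "'r set"
    and M :: "('r \<Rightarrow>\<^sub>L real) set"
    and \<kappa> \<theta> :: real
  assumes "\<exists>x::'r. x \<noteq> 0"
    and "complexification \<iota>"
    and "bounded_clinear A"
    and "real_cone K"
    and "generating_set E K" and "archimedian E K"
    and "weak_star_generating_set \<iota> M K"
    and "\<kappa> > 0" and "bounded_sectional_aperture \<kappa> K"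
    and "reproducing K"
    and "0 \<le> \<theta>" and "\<theta> < 1"
    and "transfer_matrices \<iota> E M A \<subseteq> Gamma_plus \<theta>"
  shows "eta1 \<theta> < 1 \<and>
    (\<exists>l P. spectral_gap A l P \<and> eta_sp A l P \<le> eta1 \<theta> \<and>
      (\<exists>h\<in>complexified_cone \<iota> K. \<exists>\<nu>\<in>complexified_dual_cone \<iota> K. \<exists>C::real.
        (\<forall>n\<ge>1. \<forall>x. norm (inverse (l ^ n) *\<^sub>C (A ^^ n) x - \<nu> x *\<^sub>C h)
                      \<le> C * eta1 \<theta> ^ (n - 1) * norm x) \<and>
        (\<forall>x\<in>complexified_cone \<iota> K - {0}. \<nu> x \<noteq> 0)))"
proof -
  interpret cone_contraction \<iota> K M E A \<theta>
    using assms by unfold_locales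
  show ?thesis
    using eta1_bounds(2) spectral_gap_exists[OF assms(1) less_imp_le[OF assms(8)] assms(9,10)] by (rule conjI)
qed

end
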